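(* There is a uniform computable procedure which, given a labeled well-ordering $\mathcal{L}=(L,0_L,S,p)$, computes an indecomposable well-ordering $M$ and well-orderings $\langle K(a,n)\rangle_{n\in\mathbb{N},a\in L}$ such that for all $a\in L$ and $n\in\mathbb{N}$: if $n\in Y_a$ then $K(a,n)\equiv M$; and if $n\notin Y_a$ then $K(a,n)<M$. Here $\langle Y_a\rangle_{a\in L}$ is the unique hierarchy on $L$ with $Y_{0_L}=\mathcal{L}$ (i.e., a code for the tuple $(L,0_L,S,p)$), $Y_b=Y_a'$ whenever $b$ is the successor of $a$, and $Y_b=\bigoplus_{a<_Lb}Y_a$ whenever $b$ is a limit.
   Context: A labeled well-ordering is a tuple $(L,0_L,S,p)$ where $L$ is a well-ordering (domain a subset of $\mathbb{N}$, represented by $\{\langle a,b\rangle: a\leq_L b\}$), $0_L$ its first element, $S$ the set of successor elements of $L$, and $p:S\to L$ the predecessor function. A well-ordering $X$ is indecomposable if it embeds into each of its final segments. For linear orderings $K,M$: $K\equiv M$ means each embeds into the other, and $K<M$ means $K$ embeds into $M$ but $M$ does not embed into $K$. $Y'$ denotes the Turing jump. *)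

theory Defs
  imports Main "HOL-Library.Nat_Bijection"
begin

section \<open>Oracle computability\<close>

text \<open>
  Programs for the partial functions on the naturals that are recursive relative to a set.
  All functions are unary; several arguments are passed through \<^const>\<open>prod_encode\<close>.
\<close>

datatype prog =
    PZero
  | PSucc
  | PFst
  | PSnd
  | PQuery
  | PPair prog prog
  | PComp prog prog
  | PRec prog prog
  | PMu prog

text \<open>
  \<open>computes A e x y\<close>: with oracle \<open>A\<close>, the program \<open>e\<close> halts on input \<open>x\<close> with output \<open>y\<close>.
  In \<open>mu\<close>, the values at all smaller arguments must converge and be nonzero.
\<close>

inductive computes :: "nat set \<Rightarrow> prog \<Rightarrow> nat \<Rightarrow> nat \<Rightarrow> bool" for A :: "nat set" where
  zero: "computes A PZero x 0"
| succ: "computes A PSucc x (Suc x)"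
| fst: "computes A PFst (prod_encode (x, y)) x"
| snd: "computes A PSnd (prod_encode (x, y)) y"
| query: "computes A PQuery x (if x \<in> A then 1 else 0)"
| pair: "computes A f x y \<Longrightarrow> computes A g x z \<Longrightarrow>
    computes A (PPair f g) x (prod_encode (y, z))"
| comp: "computes A g x y \<Longrightarrow> computes A f y z \<Longrightarrow> computes A (PComp f g) x z"
| rec_0: "computes A f x y \<Longrightarrow> computes A (PRec f g) (prod_encode (x, 0)) y"
| rec_Suc: "computes A (PRec f g) (prod_encode (x, n)) y \<Longrightarrow>
    computes A g (prod_encode (x, prod_encode (n, y))) z \<Longrightarrow>
    computes A (PRec f g) (prod_encode (x, Suc n)) z"
| mu: "computes A f (prod_encode (x, n)) 0 \<Longrightarrow>
    (\<forall>m<n. \<exists>k. computes A f (prod_encode (x, m)) (Suc k)) \<Longrightarrow>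
    computes A (PMu f) x n"

lemma computes_functional:
  assumes "computes A e x y" and "computes A e x z"
  shows "y = z"
  using assms
proof (induction arbitrary: z rule: computes.induct)
  case (mu f x n)
  from mu.prems obtain
    "computes A f (prod_encode (x, z)) 0"
    "\<forall>m<z. \<exists>k. computes A f (prod_encode (x, m)) (Suc k)"
    by (auto elim: computes.cases)
  then have "\<not> n < z" "\<not> z < n"
    using mu.IH by (metis nat.distinct(1))+
  then show ?case by simp
next
  case (pair f x y g z w)
  from pair.prems obtain a b where "computes A f x a" "computes A g x b" "w = prod_encode (a, b)"
    by (auto elim: computes.cases)
  with pair.IH show ?case by simp
next
  case (comp g x y f z w)
  from comp.prems obtain a where "computes A g x a" "computes A f a w"
    by (auto elim: computes.cases)
  with comp.IH show ?case by blast
next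
  case (rec_0 f x y g w)
  from rec_0.prems have "computes A f x w"
    by (cases rule: computes.cases) (auto dest: injD[OF inj_prod_encode])
  with rec_0.IH show ?case by blast
next
  case (rec_Suc f g x n y z w)
  from rec_Suc.prems obtain a where "computes A (PRec f g) (prod_encode (x, n)) a"
    "computes A g (prod_encode (x, prod_encode (n, a))) w"
    by (cases rule: computes.cases) (auto dest: injD[OF inj_prod_encode])
  with rec_Suc.IH show ?case by blast
qed (auto elim: computes.cases)

text \<open>A bijective Goedel numbering of the programs.\<close>

primrec prog_code :: "prog \<Rightarrow> nat" where
  "prog_code PZero = 0"
| "prog_code PSucc = 1"
| "prog_code PFst = 2"
| "prog_code PSnd = 3"
| "prog_code PQuery = 4"
| "prog_code (PPair f g) = 5 + 4 * prod_encode (prog_code f, prog_code g)"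
| "prog_code (PComp f g) = 6 + 4 * prod_encode (prog_code f, prog_code g)"
| "prog_code (PRec f g) = 7 + 4 * prod_encode (prog_code f, prog_code g)"
| "prog_code (PMu f) = 8 + 4 * prog_code f"

lemma bij_prog_code: "bij prog_code"
proof (rule bijI)
  show "inj prog_code"
  proof (rule injI)
    fix e e' assume "prog_code e = prog_code e'"
    then show "e = e'"
    proof (induction e arbitrary: e')
      case PZero then show ?case by (cases e') auto
    next
      case PSucc then show ?case by (cases e') auto
    next
      case PFst then show ?case by (cases e') auto
    next
      case PSnd then show ?case by (cases e') auto
    next
      case PQuery then show ?case by (cases e') auto
    next
      case (PPair f g) then show ?case by (cases e') (auto, presburger+)
    next
      case (PComp f g) then show ?case by (cases e') (auto, presburger+)
    next
      case (PRec f g) then show ?case by (cases e') (auto, presburger+)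
    next
      case (PMu f) then show ?case by (cases e') (auto, presburger+)
    qed
  qed
next
  have "n \<in> range prog_code" for n
  proof (induction n rule: less_induct)
    case (less n)
    show ?case
    proof (cases "n < 5")
      case True
      then have "n = 0 \<or> n = 1 \<or> n = 2 \<or> n = 3 \<or> n = 4" by arith
      then show ?thesis by (metis prog_code.simps(1-5) rangeI)
    next
      case False
      define q where "q = (n - 5) div 4"
      have n: "n = 5 + 4 * q \<or> n = 6 + 4 * q \<or> n = 7 + 4 * q \<or> n = 8 + 4 * q"
        using False unfolding q_def by presburger
      obtain a b where q: "q = prod_encode (a, b)"
        by (metis prod_decode_inverse surj_pair)
      have "a \<le> q" "b \<le> q"
        unfolding q by (rule le_prod_encode_1, rule le_prod_encode_2)
      with n have "a < n" "b < n" "q < n" by auto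
      with less.IH obtain f g h where "a = prog_code f" "b = prog_code g" "q = prog_code h"
        by (meson imageE)
      with n q have "n = prog_code (PPair f g) \<or> n = prog_code (PComp f g)
          \<or> n = prog_code (PRec f g) \<or> n = prog_code (PMu h)"
        by auto
      then show ?thesis by blast
    qed
  qed
  then show "surj prog_code" by auto
qed

definition decides :: "nat set \<Rightarrow> prog \<Rightarrow> nat set \<Rightarrow> bool" where
  "decides A e B \<longleftrightarrow> (\<forall>x. computes A e x (if x \<in> B then 1 else 0))"

definition turing_jump :: "nat set \<Rightarrow> nat set" where
  "turing_jump A = {prog_code e |e. \<exists>y. computes A e (prog_code e) y}"

text \<open>The effective disjoint sum of two sets, and of a family of sets.\<close>

definition join :: "nat set \<Rightarrow> nat set \<Rightarrow> nat set" (infixr \<open>\<oplus>\<close> 65) where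
  "A \<oplus> B = sum_encode ` (A <+> B)"

definition big_join :: "nat set \<Rightarrow> (nat \<Rightarrow> nat set) \<Rightarrow> nat set" where
  "big_join I Y = prod_encode ` (SIGMA i:I. Y i)"


section \<open>Embeddings of linear orderings\<close>

text \<open>
  Orderings are given by their reflexive order relation, the domain being its field.
  Embeddings need not be onto an initial segment, unlike \<^const>\<open>embed\<close>.
\<close>

definition embeds :: "'a rel \<Rightarrow> 'b rel \<Rightarrow> bool" where
  "embeds r s \<longleftrightarrow> (\<exists>f. f ` Field r \<subseteq> Field s \<and>
     (\<forall>x\<in>Field r. \<forall>y\<in>Field r. (x, y) \<in> r \<longleftrightarrow> (f x, f y) \<in> s))"

definition equimorphic :: "'a rel \<Rightarrow> 'b rel \<Rightarrow> bool" where
  "equimorphic r s \<longleftrightarrow> embeds r s \<and> embeds s r"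

definition strictly_embeds :: "'a rel \<Rightarrow> 'b rel \<Rightarrow> bool" where
  "strictly_embeds r s \<longleftrightarrow> embeds r s \<and> \<not> embeds s r"

text \<open>Final segments are nonempty; otherwise no nonempty ordering would be indecomposable.\<close>

definition final_segment :: "'a rel \<Rightarrow> 'a set \<Rightarrow> bool" where
  "final_segment r F \<longleftrightarrow> F \<subseteq> Field r \<and> F \<noteq> {} \<and> (\<forall>x\<in>F. \<forall>y. (x, y) \<in> r \<longrightarrow> y \<in> F)"

definition indecomposable :: "'a rel \<Rightarrow> bool" where
  "indecomposable r \<longleftrightarrow> (\<forall>F. final_segment r F \<longrightarrow> embeds r (Restr r F))"

definition order_code :: "nat rel \<Rightarrow> nat set" where
  "order_code r = prod_encode ` r"


section \<open>Labeled well-orderings and jump hierarchies\<close>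

text \<open>\<open>covers r a b\<close>: the element \<open>b\<close> is the immediate successor of \<open>a\<close>.\<close>

definition covers :: "'a rel \<Rightarrow> 'a \<Rightarrow> 'a \<Rightarrow> bool" where
  "covers r a b \<longleftrightarrow> (a, b) \<in> r \<and> a \<noteq> b \<and>
     (\<forall>c. (a, c) \<in> r \<and> (c, b) \<in> r \<longrightarrow> c = a \<or> c = b)"

text \<open>The values of \<open>p\<close> outside \<open>S\<close> are irrelevant and do not enter the code below.\<close>

definition labeled_well_ordering ::
    "nat rel \<Rightarrow> nat \<Rightarrow> nat set \<Rightarrow> (nat \<Rightarrow> nat) \<Rightarrow> bool" where
  "labeled_well_ordering L z S p \<longleftrightarrow>
     Well_order L \<and>
     z \<in> Field L \<and> (\<forall>a\<in>Field L. (z, a) \<in> L) \<and>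
     S = {b. \<exists>a. covers L a b} \<and>
     (\<forall>b\<in>S. covers L (p b) b)"

definition lwo_code :: "nat rel \<Rightarrow> nat \<Rightarrow> nat set \<Rightarrow> (nat \<Rightarrow> nat) \<Rightarrow> nat set" where
  "lwo_code L z S p = order_code L \<oplus> {z} \<oplus> S \<oplus> {prod_encode (b, p b) |b. b \<in> S}"

text \<open>The values of \<open>Y\<close> outside the field of \<open>L\<close> are unconstrained.\<close>

definition jump_hierarchy ::
    "nat rel \<Rightarrow> nat \<Rightarrow> nat set \<Rightarrow> (nat \<Rightarrow> nat) \<Rightarrow> (nat \<Rightarrow> nat set) \<Rightarrow> bool" where
  "jump_hierarchy L z S p Y \<longleftrightarrow>
     Y z = lwo_code L z S p \<and>
     (\<forall>a b. covers L a b \<longrightarrow> Y b = turing_jump (Y a)) \<and>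
     (\<forall>b\<in>Field L. b \<noteq> z \<and> (\<nexists>a. covers L a b) \<longrightarrow> Y b = big_join (underS L b) Y)"

lemma big_join_cong: "(\<And>i. i \<in> I \<Longrightarrow> Y i = Z i) \<Longrightarrow> big_join I Y = big_join I Z"
  unfolding big_join_def by (simp cong: Sigma_cong)

lemma jump_hierarchy_unique:
  assumes L: "labeled_well_ordering L z S p"
    and Y: "jump_hierarchy L z S p Y" and Z: "jump_hierarchy L z S p Z"
    and "a \<in> Field L"
  shows "Y a = Z a"
proof -
  interpret wo_rel L
    using L by (simp add: labeled_well_ordering_def wo_rel_def)
  have "a \<in> Field L \<longrightarrow> Y a = Z a" for a
  proof (induction a rule: well_order_induct)
    case (1 b)
    consider "b = z" | a where "covers L a b" | "b \<noteq> z" "\<nexists>a. covers L a b" by blast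
    then show ?case
    proof cases
      case 1
      then show ?thesis using Y Z by (simp add: jump_hierarchy_def)
    next
      case (2 a)
      then have "Y a = Z a"
        using "1" by (auto simp: covers_def intro: FieldI1)
      with 2 show ?thesis using Y Z by (simp add: jump_hierarchy_def)
    next
      case 3
      have "big_join (underS b) Y = big_join (underS b) Z"
        using "1" by (intro big_join_cong) (auto simp: underS_def intro: FieldI1)
      with 3 show ?thesis using Y Z by (simp add: jump_hierarchy_def)
    qed
  qed
  with assms(4) show ?thesis by blast
qed

lemma jump_hierarchy_exists:
  assumes L: "labeled_well_ordering L z S p"
  shows "\<exists>Y. jump_hierarchy L z S p Y"
proof -
  interpret wo_rel L
    using L by (simp add: labeled_well_ordering_def wo_rel_def)
  define H where "H Y b = (if b = z then lwo_code L z S p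
      else if b \<in> S then turing_jump (Y (p b)) else big_join (underS b) Y)" for Y b
  have S: "S = {b. \<exists>a. covers L a b}" and p: "\<And>b. b \<in> S \<Longrightarrow> covers L (p b) b"
    and z: "\<And>a. a \<in> Field L \<Longrightarrow> (z, a) \<in> L"
    using L unfolding labeled_well_ordering_def by blast+
  have "adm_wo H"
    unfolding adm_wo_def
  proof (intro allI impI)
    fix f g :: "nat \<Rightarrow> nat set" and b
    assume *: "\<forall>y\<in>underS b. f y = g y"
    have "p b \<in> underS b" if "b \<in> S"
      using p[OF that] by (simp add: covers_def underS_def)
    moreover have "big_join (underS b) f = big_join (underS b) g"
      using * by (intro big_join_cong) simp
    ultimately show "H f b = H g b"
      using * by (simp add: H_def)
  qed
  then have worec_eq: "worec H b = H (worec H) b" for b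
    using worec_fixpoint by metis
  have unique: "a = a'" if "covers L a b" "covers L a' b" for a a' b
    using that TOTALS unfolding covers_def by (metis FieldI1)
  have not_z: "b \<noteq> z" if "covers L a b" for a b
    using that z[of a] ANTISYM unfolding covers_def by (metis FieldI1 antisymD)
  have "jump_hierarchy L z S p (worec H)"
    unfolding jump_hierarchy_def
  proof (intro conjI allI impI ballI)
    show "worec H z = lwo_code L z S p"
      by (subst worec_eq) (simp add: H_def)
  next
    fix a b assume ab: "covers L a b"
    then have "b \<in> S" by (auto simp: S)
    moreover from this have "p b = a" using p unique ab by blast
    ultimately show "worec H b = turing_jump (worec H a)"
      using not_z[OF ab] by (subst worec_eq) (simp add: H_def)
  next
    fix b assume "b \<noteq> z \<and> (\<nexists>a. covers L a b)"
    then show "worec H b = big_join (underS b) (worec H)"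
      by (subst worec_eq) (simp add: H_def S)
  qed
  then show ?thesis by blast
qed

end

(*
  Kleene-Brouwer orderings of trees turn "has an infinite branch" into "is as long as possible".
  Let M be the Kleene-Brouwer ordering of all nonempty finite sequences of labels whose first
  components descend in a fixed well-founded relation, and let K be its restriction to the sequences
  whose second components are finite attempts at a proof of a claim c.  An infinite proof of c can be
  threaded through every sequence, so M embeds into K.  If the attempts have ranks in the well-founded
  relation below some m, then K embeds below a node with first component m, hence strictly into M.

  A proof is a binary tree of claims in which the children of every claim justify it by a rule that
  is decidable in the code of L.  The claims are "n is in Y_a", "n is not in Y_a", "the configuration w
  halts within k steps with oracle Y_a" and "w never halts with oracle Y_a", with one machine step per
  rule.  Divergence is justified by the divergence of the next
  configuration, so two premises always suffice because proofs may be infinite.  A false claim always has a false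
  child of smaller rank in L x N, which bounds the failed attempts uniformly.
*)
theory Submission
  imports Defs
begin

section \<open>Functions computable uniformly in the oracle\<close>

definition pfst :: "nat \<Rightarrow> nat" where "pfst n = fst (prod_decode n)"
definition psnd :: "nat \<Rightarrow> nat" where "psnd n = snd (prod_decode n)"

lemma pfst_encode [simp]: "pfst (prod_encode (x, y)) = x"
  and psnd_encode [simp]: "psnd (prod_encode (x, y)) = y"
  and prod_encode_pfst_psnd [simp]: "prod_encode (pfst n, psnd n) = n"
  by (simp_all add: pfst_def psnd_def)

text \<open>The number 0 serves both as the trivial claim and as the empty list. These values give
  the trivial claim tag 0 and let the tail of the empty list be empty.\<close>

lemma pfst_0 [simp]: "pfst 0 = 0" and psnd_0 [simp]: "psnd 0 = 0"
proof -
  have "prod_encode (0, 0) = 0" by (simp add: prod_encode_def)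
  then show "pfst 0 = 0" "psnd 0 = 0" by (metis pfst_encode, metis psnd_encode)
qed

text \<open>One program serves all oracles; this is the uniformity that the theorem asks
  for.\<close>

definition ucomputable :: "(nat set \<Rightarrow> nat \<Rightarrow> nat) \<Rightarrow> bool" where
  "ucomputable F \<longleftrightarrow> (\<exists>e. \<forall>A x. computes A e x (F A x))"

definition udecidable :: "(nat set \<Rightarrow> nat \<Rightarrow> bool) \<Rightarrow> bool" where
  "udecidable P \<longleftrightarrow> ucomputable (\<lambda>A x. if P A x then 1 else 0)"

named_theorems ucomp

lemma ucomputable_pair [ucomp]:
  assumes "ucomputable F" and "ucomputable G"
  shows "ucomputable (\<lambda>A x. prod_encode (F A x, G A x))"
  using assms computes.pair unfolding ucomputable_def by metis

lemma ucomputable_comp: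
  assumes "ucomputable F" and "ucomputable G"
  shows "ucomputable (\<lambda>A x. F A (G A x))"
  using assms computes.comp unfolding ucomputable_def by metis

lemma ucomputable_pfst [ucomp]:
  assumes "ucomputable F"
  shows "ucomputable (\<lambda>A x. pfst (F A x))"
proof -
  have "computes A PFst x (pfst x)" for A x
    using computes.fst[of A "pfst x" "psnd x"] by simp
  then have "ucomputable (\<lambda>A. pfst)" unfolding ucomputable_def by blast
  from ucomputable_comp[OF this assms] show ?thesis .
qed

lemma ucomputable_psnd [ucomp]:
  assumes "ucomputable F"
  shows "ucomputable (\<lambda>A x. psnd (F A x))"
proof -
  have "computes A PSnd x (psnd x)" for A x
    using computes.snd[of A "pfst x" "psnd x"] by simp
  then have "ucomputable (\<lambda>A. psnd)" unfolding ucomputable_def by blast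
  from ucomputable_comp[OF this assms] show ?thesis .
qed

lemma ucomputable_id [ucomp]: "ucomputable (\<lambda>A x. x)"
proof -
  have "computes A (PPair PFst PSnd) (prod_encode (a, b)) (prod_encode (a, b))" for A a b
    by (intro computes.intros)
  then have "computes A (PPair PFst PSnd) x x" for A x
    by (metis prod_encode_pfst_psnd)
  then show ?thesis unfolding ucomputable_def by blast
qed

lemma ucomputable_Suc [ucomp]:
  assumes "ucomputable F"
  shows "ucomputable (\<lambda>A x. Suc (F A x))"
proof -
  have "ucomputable (\<lambda>A. Suc)" unfolding ucomputable_def using computes.succ by blast
  from ucomputable_comp[OF this assms] show ?thesis .
qed

lemma ucomputable_const [ucomp]: "ucomputable (\<lambda>A x. c)"
proof (induction c)
  case 0
  show ?case unfolding ucomputable_def using computes.zero by blast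
next
  case (Suc c)
  then show ?case by (rule ucomputable_Suc)
qed

text \<open>Programs are unary, so the step function is assumed computable on coded triples of
  parameter, counter and previous value, the shape in which \<open>PRec\<close> feeds it.\<close>

lemma ucomputable_rec:
  assumes f: "ucomputable f"
    and g: "ucomputable (\<lambda>A z. g A (pfst z) (pfst (psnd z)) (psnd (psnd z)))"
    and n: "ucomputable n"
  shows "ucomputable (\<lambda>A x. rec_nat (f A x) (g A x) (n A x))"
proof -
  from f obtain ef where ef: "\<And>A x. computes A ef x (f A x)"
    unfolding ucomputable_def by blast
  from g obtain eg where eg:
    "\<And>A z. computes A eg z (g A (pfst z) (pfst (psnd z)) (psnd (psnd z)))"
    unfolding ucomputable_def by blast
  have "computes A (PRec ef eg) (prod_encode (x, k)) (rec_nat (f A x) (g A x) k)" for A x k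
  proof (induction k)
    case 0
    show ?case using computes.rec_0[OF ef] by simp
  next
    case (Suc k)
    from computes.rec_Suc[OF Suc eg] show ?case by simp
  qed
  then have "computes A (PRec ef eg) z (rec_nat (f A (pfst z)) (g A (pfst z)) (psnd z))" for A z
    by (metis prod_encode_pfst_psnd)
  then have "ucomputable (\<lambda>A z. rec_nat (f A (pfst z)) (g A (pfst z)) (psnd z))"
    unfolding ucomputable_def by blast
  from ucomputable_comp[OF this ucomputable_pair[OF ucomputable_id n]] show ?thesis by simp
qed

lemma ucomputable_pred [ucomp]:
  assumes "ucomputable F"
  shows "ucomputable (\<lambda>A x. F A x - 1)"
proof -
  have "ucomputable (\<lambda>A x. rec_nat 0 (\<lambda>i _. i) (F A x))"
    by (intro ucomputable_rec ucomp assms)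
  moreover have "rec_nat 0 (\<lambda>i _. i) n = n - 1" for n :: nat by (cases n) auto
  ultimately show ?thesis by simp
qed

lemma ucomputable_diff [ucomp]:
  assumes "ucomputable F" and "ucomputable G"
  shows "ucomputable (\<lambda>A x. F A x - G A x)"
proof -
  have "ucomputable (\<lambda>A x. rec_nat (F A x) (\<lambda>_ y. y - 1) (G A x))"
    by (intro ucomputable_rec ucomp assms)
  moreover have "rec_nat m (\<lambda>_ y. y - 1) n = m - n" for m n :: nat by (induction n) auto
  ultimately show ?thesis by simp
qed

lemma ucomputable_add [ucomp]:
  assumes "ucomputable F" and "ucomputable G"
  shows "ucomputable (\<lambda>A x. F A x + G A x)"
proof -
  have "ucomputable (\<lambda>A x. rec_nat (F A x) (\<lambda>_ y. Suc y) (G A x))"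
    by (intro ucomputable_rec ucomp assms)
  moreover have "rec_nat m (\<lambda>_ y. Suc y) n = m + n" for m n :: nat by (induction n) auto
  ultimately show ?thesis by simp
qed

lemma ucomputable_mult [ucomp]:
  assumes "ucomputable F" and "ucomputable G"
  shows "ucomputable (\<lambda>A x. F A x * G A x)"
proof -
  have "ucomputable (\<lambda>A x. rec_nat 0 (\<lambda>_ y. y + F A x) (G A x))"
    by (intro ucomputable_rec ucomp assms ucomputable_comp[OF assms(1)])
  moreover have "rec_nat 0 (\<lambda>_ y. y + m) n = m * n" for m n :: nat by (induction n) auto
  ultimately show ?thesis by simp
qed

lemma ucomputable_if [ucomp]:
  assumes "udecidable P" and "ucomputable F" and "ucomputable G"
  shows "ucomputable (\<lambda>A x. if P A x then F A x else G A x)"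
proof -
  \<comment> \<open>A case distinction is a recursion of length 0 or 1.\<close>
  have "ucomputable (\<lambda>A x. rec_nat (G A x) (\<lambda>_ _. F A x) (if P A x then 1 else 0))"
    using assms unfolding udecidable_def
    by (intro ucomputable_rec ucomp ucomputable_comp[OF assms(2)])
  moreover have "rec_nat b (\<lambda>_ _. a) (if p then 1 else 0) = (if p then a else b)"
    for a b :: nat and p by simp
  ultimately show ?thesis by simp
qed

section \<open>Predicates decidable uniformly in the oracle\<close>

lemma udecidable_comp:
  assumes "udecidable P" and "ucomputable G"
  shows "udecidable (\<lambda>A x. P A (G A x))"
  using ucomputable_comp[OF assms(1)[unfolded udecidable_def] assms(2)]
  by (simp add: udecidable_def)

lemma udecidable_oracle [ucomp]:
  assumes "ucomputable F"
  shows "udecidable (\<lambda>A x. F A x \<in> A)"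
proof -
  have "ucomputable (\<lambda>A x. if x \<in> A then 1 else 0)"
    unfolding ucomputable_def using computes.query by blast
  then have "udecidable (\<lambda>A x. x \<in> A)" by (simp add: udecidable_def)
  from udecidable_comp[OF this assms] show ?thesis .
qed

lemma udecidable_not [ucomp]:
  assumes "udecidable P"
  shows "udecidable (\<lambda>A x. \<not> P A x)"
proof -
  have "ucomputable (\<lambda>A x. if P A x then 0 else 1)" by (intro ucomp assms)
  moreover have "(if \<not> p then 1 else 0) = (if p then 0 else 1 :: nat)" for p by simp
  ultimately show ?thesis by (simp add: udecidable_def)
qed

lemma udecidable_if [ucomp]:
  assumes "udecidable P" and "udecidable Q" and "udecidable R"
  shows "udecidable (\<lambda>A x. if P A x then Q A x else R A x)"
proof -
  have "ucomputable (\<lambda>A x. if P A x then (if Q A x then 1 else 0) else (if R A x then 1 else 0))"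
    by (intro ucomp assms)
  then show ?thesis unfolding udecidable_def by (rule back_subst[of ucomputable]) (auto simp: fun_eq_iff)
qed

lemma udecidable_const [ucomp]: "udecidable (\<lambda>A x. c)"
  unfolding udecidable_def by (rule ucomputable_const)

lemma udecidable_conj [ucomp]:
  assumes "udecidable P" and "udecidable Q"
  shows "udecidable (\<lambda>A x. P A x \<and> Q A x)"
  using udecidable_if[OF assms udecidable_const[of False]]
  by (rule back_subst[of udecidable]) (auto simp: fun_eq_iff)

lemma udecidable_disj [ucomp]:
  assumes "udecidable P" and "udecidable Q"
  shows "udecidable (\<lambda>A x. P A x \<or> Q A x)"
  using udecidable_if[OF assms(1) udecidable_const[of True] assms(2)]
  by (rule back_subst[of udecidable]) (auto simp: fun_eq_iff)

lemma udecidable_imp [ucomp]: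
  assumes "udecidable P" and "udecidable Q"
  shows "udecidable (\<lambda>A x. P A x \<longrightarrow> Q A x)"
  using udecidable_if[OF assms udecidable_const[of True]]
  by (rule back_subst[of udecidable]) (auto simp: fun_eq_iff)

lemma udecidable_eq_0:
  assumes "ucomputable F"
  shows "udecidable (\<lambda>A x. F A x = 0)"
proof -
  have "ucomputable (\<lambda>A x. 1 - F A x)" by (intro ucomp assms)
  moreover have "1 - n = (if n = 0 then 1 else 0)" for n :: nat by simp
  ultimately show ?thesis by (simp add: udecidable_def)
qed

lemma udecidable_le [ucomp]:
  assumes "ucomputable F" and "ucomputable G"
  shows "udecidable (\<lambda>A x. F A x \<le> G A x)"
  using udecidable_eq_0[OF ucomputable_diff[OF assms]] by simp

lemma udecidable_less [ucomp]:
  assumes "ucomputable F" and "ucomputable G"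
  shows "udecidable (\<lambda>A x. F A x < G A x)"
  using udecidable_le[OF ucomputable_Suc[OF assms(1)] assms(2)] by (simp add: Suc_le_eq)

lemma udecidable_eq [ucomp]:
  assumes "ucomputable F" and "ucomputable G"
  shows "udecidable (\<lambda>A x. F A x = G A x)"
  using udecidable_conj[OF udecidable_le[OF assms] udecidable_le[OF assms(2,1)]]
  by (simp add: order_eq_iff)

lemma udecidable_ball [ucomp]:
  assumes n: "ucomputable n" and P: "udecidable (\<lambda>A z. P A (pfst z) (psnd z))"
  shows "udecidable (\<lambda>A x. \<forall>i<n A x. P A x i)"
proof -
  have P': "udecidable (\<lambda>A z. P A (pfst z) (pfst (psnd z)))"
    using udecidable_comp[OF P, of "\<lambda>A z. prod_encode (pfst z, pfst (psnd z))"]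
    by (simp add: ucomp)
  have "ucomputable (\<lambda>A x. rec_nat 1 (\<lambda>i y. if P A x i then y else 0) (n A x))"
    by (intro ucomputable_rec ucomp n P')
  moreover have "rec_nat 1 (\<lambda>i y. if Q i then y else 0) k = (if \<forall>i<k. Q i then 1 else 0 :: nat)"
    for Q k by (induction k) (auto simp: less_Suc_eq)
  ultimately show ?thesis by (simp add: udecidable_def)
qed

lemma udecidable_bex [ucomp]:
  assumes "ucomputable n" and "udecidable (\<lambda>A z. P A (pfst z) (psnd z))"
  shows "udecidable (\<lambda>A x. \<exists>i<n A x. P A x i)"
proof -
  have "udecidable (\<lambda>A x. \<not> (\<forall>i<n A x. \<not> P A x i))" by (intro ucomp assms)
  then show ?thesis by simp
qed

text \<open>The divisor is constant and written as a successor, hence nonzero; later terms spell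
  \<open>Suc 3\<close> and \<open>Suc 1\<close> to match.\<close>

lemma ucomputable_mod [ucomp]:
  assumes "ucomputable F"
  shows "ucomputable (\<lambda>A x. F A x mod Suc k)"
proof -
  have "ucomputable (\<lambda>A x. rec_nat 0 (\<lambda>_ y. if y = k then 0 else Suc y) (F A x))"
    by (intro ucomputable_rec ucomp assms)
  moreover have "rec_nat 0 (\<lambda>_ y. if y = k then 0 else Suc y) n = n mod Suc k" for n
    by (induction n) (auto simp: mod_Suc)
  ultimately show ?thesis by simp
qed

lemma ucomputable_div [ucomp]:
  assumes "ucomputable F"
  shows "ucomputable (\<lambda>A x. F A x div Suc k)"
proof -
  have "ucomputable (\<lambda>A x. rec_nat 0 (\<lambda>i y. if Suc i mod Suc k = 0 then Suc y else y) (F A x))"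
    by (intro ucomputable_rec ucomp assms)
  moreover have "rec_nat 0 (\<lambda>i y. if Suc i mod Suc k = 0 then Suc y else y) n = n div Suc k" for n
    by (induction n) (auto simp: div_Suc)
  ultimately show ?thesis by simp
qed


section \<open>Kleene-Brouwer orderings\<close>

fun kb :: "nat list \<Rightarrow> nat list \<Rightarrow> bool" where
  "kb (x # xs) (y # ys) \<longleftrightarrow> x < y \<or> x = y \<and> kb xs ys"
| "kb (x # xs) [] \<longleftrightarrow> True"
| "kb [] ys \<longleftrightarrow> False"

lemma kb_irrefl [simp]: "\<not> kb xs xs"
  by (induction xs) auto

lemma kb_trans: "kb xs ys \<Longrightarrow> kb ys zs \<Longrightarrow> kb xs zs"
proof (induction xs ys arbitrary: zs rule: kb.induct)
  case (1 x xs y ys)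
  then show ?case by (cases zs) auto
qed auto

lemma kb_total: "xs \<noteq> ys \<Longrightarrow> kb xs ys \<or> kb ys xs"
proof (induction xs ys rule: kb.induct)
  case (3 ys)
  then show ?case by (cases ys) auto
qed auto

lemma kb_append [simp]: "kb (us @ xs) (us @ ys) \<longleftrightarrow> kb xs ys"
  by (induction us) auto

text \<open>Here \<open>i\<close> is the first position where the sequences differ or
  \<open>ys\<close> has ended. This form has only bounded quantifiers, which makes the ordering
  decidable on codes.\<close>

lemma kb_nth:
  "kb xs ys \<longleftrightarrow> (\<exists>i<length xs. i \<le> length ys \<and> (\<forall>j<i. xs ! j = ys ! j) \<and>
     (i < length ys \<longrightarrow> xs ! i < ys ! i))"
proof (induction xs ys rule: kb.induct)
  case (1 x xs y ys)
  show ?case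
    by (simp add: 1 Ex_less_Suc2 All_less_Suc2 cong: conj_cong) blast
qed auto

section \<open>The ordering on codes of sequences and its well-foundedness\<close>

definition kb_order :: "nat list set \<Rightarrow> nat rel" where
  "kb_order T = {(list_encode xs, list_encode ys) |xs ys.
     xs \<in> T \<and> ys \<in> T \<and> (xs = ys \<or> kb xs ys)}"

lemma kb_order_iff [simp]:
  "(list_encode xs, list_encode ys) \<in> kb_order T \<longleftrightarrow>
     xs \<in> T \<and> ys \<in> T \<and> (xs = ys \<or> kb xs ys)"
  by (auto simp: kb_order_def list_encode_eq)

lemma Field_kb_order [simp]: "Field (kb_order T) = list_encode ` T"
  by (auto simp: kb_order_def Field_def)

text \<open>Passes from codes to lists and from the reflexive order to \<open>kb\<close>; the latter
  is possible because \<open>kb\<close> is a strict linear order.\<close>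

lemma embeds_kb_order_iff:
  "embeds (kb_order T) (kb_order U) \<longleftrightarrow>
     (\<exists>h. (\<forall>xs\<in>T. h xs \<in> U) \<and> (\<forall>xs\<in>T. \<forall>ys\<in>T. kb (h xs) (h ys) \<longleftrightarrow> kb xs ys))"
  (is "?l \<longleftrightarrow> ?r")
proof
  assume ?l
  then obtain f where f: "f ` list_encode ` T \<subseteq> list_encode ` U"
    and iff: "\<And>xs ys. xs \<in> T \<Longrightarrow> ys \<in> T \<Longrightarrow> xs = ys \<or> kb xs ys \<longleftrightarrow>
      (f (list_encode xs), f (list_encode ys)) \<in> kb_order U"
    unfolding embeds_def by (auto simp: ball_simps)
  define h where "h xs = list_decode (f (list_encode xs))" for xs
  have h: "h xs \<in> U" if "xs \<in> T" for xs
    using f that unfolding h_def by (force simp: image_subset_iff)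
  have fh: "f (list_encode xs) = list_encode (h xs)" for xs
    by (simp add: h_def)
  have *: "h xs = h ys \<or> kb (h xs) (h ys) \<longleftrightarrow> xs = ys \<or> kb xs ys"
    if "xs \<in> T" "ys \<in> T" for xs ys
    using iff[OF that] h that by (simp add: fh)
  have "kb (h xs) (h ys) \<longleftrightarrow> kb xs ys" if "xs \<in> T" "ys \<in> T" for xs ys
    using *[of xs ys] *[of ys xs] that by (metis kb_irrefl kb_trans)
  with h show ?r by blast
next
  assume ?r
  then obtain h where h: "\<And>xs. xs \<in> T \<Longrightarrow> h xs \<in> U"
    and iff: "\<And>xs ys. xs \<in> T \<Longrightarrow> ys \<in> T \<Longrightarrow> kb (h xs) (h ys) \<longleftrightarrow> kb xs ys"
    by blast
  have "h xs = h ys \<or> kb (h xs) (h ys) \<longleftrightarrow> xs = ys \<or> kb xs ys" if "xs \<in> T" "ys \<in> T" for xs ys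
    using iff that by (metis kb_irrefl kb_total)
  with h show ?l
    unfolding embeds_def
    by (intro exI[of _ "list_encode \<circ> h \<circ> list_decode"]) auto
qed

text \<open>The empty sequence is left out: it would be the greatest element, and the final segment
  consisting of it alone would refute indecomposability.\<close>

definition descents :: "nat rel \<Rightarrow> nat list set" where
  "descents R = {xs. xs \<noteq> [] \<and> (\<forall>i. Suc i < length xs \<longrightarrow> (pfst (xs ! Suc i), pfst (xs ! i)) \<in> R)}"

text \<open>Call a node good if every nonempty set of descents extending it has a
  \<open>kb\<close>-least element. A node is good once its one-label extensions leading to descents
  are, and along descents the first components go down in the well-founded \<open>R\<close>.\<close>

lemma kb_minimal:
  assumes R: "wf R" and Q: "Q \<subseteq> descents R" "Q \<noteq> {}"
  shows "\<exists>xs\<in>Q. \<forall>ys\<in>Q. \<not> kb ys xs"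
proof -
  define P where "P us \<longleftrightarrow> (\<forall>Q. Q \<subseteq> descents R \<and> Q \<noteq> {} \<and> (\<forall>xs\<in>Q. \<exists>vs. xs = us @ vs) \<longrightarrow>
    (\<exists>xs\<in>Q. \<forall>ys\<in>Q. \<not> kb ys xs))" for us
  have step: "P us" if P: "\<And>x vs. us @ x # vs \<in> descents R \<Longrightarrow> P (us @ [x])" for us
    unfolding P_def
  proof (intro allI impI)
    fix Q
    assume "Q \<subseteq> descents R \<and> Q \<noteq> {} \<and> (\<forall>xs\<in>Q. \<exists>vs. xs = us @ vs)"
    then have Q: "Q \<subseteq> descents R" "Q \<noteq> {}" and us: "\<And>xs. xs \<in> Q \<Longrightarrow> \<exists>vs. xs = us @ vs"
      by auto
    show "\<exists>xs\<in>Q. \<forall>ys\<in>Q. \<not> kb ys xs"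
    proof (cases "\<exists>x vs. us @ x # vs \<in> Q")
      case False
      with us have "xs = us" if "xs \<in> Q" for xs
        using that by (metis append_Nil2 neq_Nil_conv)
      with Q(2) show ?thesis by (metis kb_irrefl ex_in_conv)
    next
      case True
      \<comment> \<open>A sequence that continues with the least possible label lies below
        \<open>us\<close> itself and below all sequences that continue with another label.\<close>
      define x where "x = (LEAST x. \<exists>vs. us @ x # vs \<in> Q)"
      obtain vs where vs: "us @ x # vs \<in> Q"
        using LeastI_ex[OF True] unfolding x_def by blast
      have x: "x \<le> y" if "us @ y # ws \<in> Q" for y ws
        unfolding x_def using that by (intro Least_le) blast
      define Q' where "Q' = {xs \<in> Q. \<exists>vs. xs = us @ x # vs}"
      have "P (us @ [x])" using P vs Q(1) by blast
      moreover have "Q' \<subseteq> descents R" "Q' \<noteq> {}" "\<forall>xs\<in>Q'. \<exists>vs. xs = (us @ [x]) @ vs"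
        using Q(1) vs by (auto simp: Q'_def)
      ultimately obtain xs where xs: "xs \<in> Q'" "\<And>ys. ys \<in> Q' \<Longrightarrow> \<not> kb ys xs"
        unfolding P_def by meson
      from xs(1) obtain ws where ws: "xs = us @ x # ws" "xs \<in> Q" by (auto simp: Q'_def)
      have "\<not> kb ys xs" if ys: "ys \<in> Q" for ys
      proof -
        obtain us' where us': "ys = us @ us'" using us ys by blast
        show ?thesis
        proof (cases us')
          case Nil
          then show ?thesis using kb_append[of us "[]"] by (simp add: us' ws)
        next
          case (Cons y ts)
          then have "x \<le> y" using x ys us' by blast
          then show ?thesis
            using xs(2)[of ys] ys by (auto simp: us' Cons ws Q'_def)
        qed
      qed
      with ws show ?thesis by blast
    qed
  qed
  have "P (us @ [x])" if "pfst x = m" for us x m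
    using R that
  proof (induction m arbitrary: us x rule: wf_induct_rule)
    case (less m)
    show ?case
    proof (rule step)
      fix y vs
      assume "(us @ [x]) @ y # vs \<in> descents R"
      then have "(pfst y, pfst x) \<in> R"
        by (auto simp: descents_def nth_append dest: spec[of _ "length us"])
      with less show "P ((us @ [x]) @ [y])" by blast
    qed
  qed
  \<comment> \<open>The empty node has no last label to induct on, so it takes one more application
    of \<open>step\<close>.\<close>
  then have "P [] " using step[of "[]"] by (metis)
  with Q show ?thesis unfolding P_def by simp
qed

lemma Well_order_kb_order:
  assumes "wf R" and "T \<subseteq> descents R"
  shows "Well_order (kb_order T)"
proof -
  have "wf (kb_order T - Id)"
    unfolding wf_eq_minimal2
  proof (intro allI impI)
    fix A assume A: "A \<subseteq> Field (kb_order T - Id) \<and> A \<noteq> {}"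
    have "Field (kb_order T - Id) \<subseteq> list_encode ` T"
      using mono_Field[of "kb_order T - Id" "kb_order T"] by auto
    with A have A': "A \<subseteq> list_encode ` T" by blast
    let ?Q = "list_decode ` A"
    have "?Q \<subseteq> T" using A' by force
    with A assms(2) have "?Q \<subseteq> descents R" "?Q \<noteq> {}" by auto
    then obtain xs where xs: "xs \<in> ?Q" "\<And>ys. ys \<in> ?Q \<Longrightarrow> \<not> kb ys xs"
      using kb_minimal[OF assms(1)] by meson
    show "\<exists>a\<in>A. \<forall>b\<in>A. (b, a) \<notin> kb_order T - Id"
    proof (intro bexI ballI)
      show "list_encode xs \<in> A" using xs(1) by auto
      fix b assume b: "b \<in> A"
      then have "\<not> kb (list_decode b) xs" using xs(2) by auto
      moreover have "(list_encode (list_decode b), list_encode xs) \<in> kb_order T \<longleftrightarrow>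
        list_decode b \<in> T \<and> xs \<in> T \<and> (list_decode b = xs \<or> kb (list_decode b) xs)"
        by (rule kb_order_iff)
      ultimately show "(b, list_encode xs) \<notin> kb_order T - Id" by auto
    qed
  qed
  moreover have "Linear_order (kb_order T)"
    unfolding linear_order_on_def partial_order_on_def preorder_on_def
  proof (intro conjI)
    show "refl_on (Field (kb_order T)) (kb_order T)" by (auto simp: refl_on_def)
    show "trans (kb_order T)"
      by (rule transI) (auto simp: kb_order_def list_encode_eq intro: kb_trans)
    show "antisym (kb_order T)"
      by (rule antisymI) (auto simp: kb_order_def list_encode_eq dest: kb_trans)
    show "total_on (Field (kb_order T)) (kb_order T)"
      using kb_total by (auto simp: total_on_def)
  qed (auto simp: kb_order_def Field_def)
  ultimately show ?thesis by (simp add: well_order_on_def)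
qed

section \<open>Relabelling of sequences and indecomposability\<close>

fun relabel :: "(nat list \<Rightarrow> nat \<Rightarrow> nat) \<Rightarrow> nat list \<Rightarrow> nat list \<Rightarrow> nat list" where
  "relabel g us [] = []"
| "relabel g us (x # xs) = g us x # relabel g (us @ [x]) xs"

lemma length_relabel [simp]: "length (relabel g us xs) = length xs"
  by (induction xs arbitrary: us) auto

lemma relabel_eq_Nil [simp]: "relabel g us xs = [] \<longleftrightarrow> xs = []"
  by (cases xs) auto

lemma nth_relabel [simp]:
  "i < length xs \<Longrightarrow> relabel g us xs ! i = g (us @ take i xs) (xs ! i)"
  by (induction xs arbitrary: us i) (auto simp: nth_Cons split: nat.split)

text \<open>Up to the first difference both sequences have the same prefix, so the labels there are
  compared through the same increasing function. Hence that function may depend on the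
  prefix.\<close>

lemma kb_relabel:
  assumes "\<And>us. strict_mono (g us)"
  shows "kb (relabel g us xs) (relabel g us ys) \<longleftrightarrow> kb xs ys"
proof (induction xs ys arbitrary: us rule: kb.induct)
  case (1 x xs y ys)
  then show ?case
    using strict_mono_less[OF assms] strict_mono_eq[OF assms] by auto
qed auto

text \<open>Labels carry a third, free component, so that the first two can be prescribed while the
  numerical order of the labels is preserved.\<close>

lemma strict_mono_label_exists:
  fixes a b :: "nat \<Rightarrow> nat"
  shows "\<exists>g. strict_mono g \<and> (\<forall>e. pfst (g e) = a e \<and> pfst (psnd (g e)) = b e \<and> N \<le> g e)"
proof -
  define g where "g = rec_nat (prod_encode (a 0, prod_encode (b 0, N)))
    (\<lambda>e y. prod_encode (a (Suc e), prod_encode (b (Suc e), Suc y)))"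
  have le: "y \<le> prod_encode (u, prod_encode (v, y))" for u v y
    using le_prod_encode_2 order_trans by blast
  have g0: "g 0 = prod_encode (a 0, prod_encode (b 0, N))"
    and gS: "g (Suc e) = prod_encode (a (Suc e), prod_encode (b (Suc e), Suc (g e)))" for e
    by (simp_all add: g_def)
  have "g e < g (Suc e)" for e
    using le[of "Suc (g e)"] by (simp add: gS Suc_le_eq)
  then have mono: "strict_mono g" by (simp add: strict_mono_Suc_iff)
  moreover have "N \<le> g 0" using le by (simp add: g0)
  then have "N \<le> g e" for e
    using strict_mono_less_eq[OF mono, of 0 e] by simp
  moreover have "pfst (g e) = a e \<and> pfst (psnd (g e)) = b e" for e
    by (cases e) (simp_all add: g0 gS)
  ultimately show ?thesis by blast
qed

text \<open>Pick \<open>us\<close> in the final segment. Replacing labels by numerically larger ones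
  with the same first component keeps descents; if all new labels exceed the first label of
  \<open>us\<close>, the image lies above \<open>us\<close> and so in the segment.\<close>

lemma indecomposable_kb_descents: "indecomposable (kb_order (descents R))"
  unfolding indecomposable_def
proof (intro allI impI)
  fix F assume F: "final_segment (kb_order (descents R)) F"
  then have "F \<noteq> {}" "F \<subseteq> list_encode ` descents R"
    by (auto simp: final_segment_def)
  then obtain us where us: "us \<in> descents R" "list_encode us \<in> F" by blast
  obtain g where g: "strict_mono g" "\<And>e. pfst (g e) = pfst e" "\<And>e. Suc (us ! 0) \<le> g e"
    using strict_mono_label_exists[of pfst "\<lambda>_. 0" "Suc (us ! 0)"] by blast
  let ?h = "relabel (\<lambda>_. g) []"
  define U where "U = {xs \<in> descents R. kb us xs}"
  have "embeds (kb_order (descents R)) (kb_order U)"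
    unfolding embeds_kb_order_iff
  proof (intro exI[of _ ?h] conjI ballI)
    fix xs assume xs: "xs \<in> descents R"
    then have "?h xs \<in> descents R" by (auto simp: descents_def g(2))
    moreover have "kb us (?h xs)"
    proof -
      obtain y ys x xs' where "us = y # ys" "xs = x # xs'"
        using us(1) xs by (cases us; cases xs) (auto simp: descents_def)
      then show ?thesis using g(3)[of x] by simp
    qed
    ultimately show "?h xs \<in> U" by (simp add: U_def)
  qed (use g(1) in \<open>simp add: kb_relabel\<close>)
  moreover have "embeds (kb_order U) (Restr (kb_order (descents R)) F)"
  proof -
    have U: "list_encode xs \<in> F" if "xs \<in> U" for xs
      using F us that unfolding final_segment_def U_def by force
    \<comment> \<open>Reflexive pairs keep these codes in the field of the restricted order.\<close>
    then have "(list_encode xs, list_encode xs) \<in> Restr (kb_order (descents R)) F" if "xs \<in> U" for xs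
      using that by (simp add: U_def)
    then have "list_encode ` U \<subseteq> Field (Restr (kb_order (descents R)) F)"
      by (meson FieldI1 image_subsetI)
    with U show ?thesis
      unfolding embeds_def
      by (intro exI[of _ id]) (auto simp: U_def)
  qed
  ultimately show "embeds (kb_order (descents R)) (Restr (kb_order (descents R)) F)"
    unfolding embeds_def by (smt (verit) comp_apply image_comp image_subset_iff)
qed

section \<open>Orderings of proof attempts compared with the ordering of all descents\<close>

abbreviation claim :: "nat \<Rightarrow> nat" where "claim x \<equiv> pfst (psnd x)"

text \<open>The sequence lists the claims of a binary tree in heap order: the children of position
  \<open>i\<close> are the positions \<open>2 * i + 1\<close> and \<open>2 * i + 2\<close>.\<close>

definition proofs :: "nat rel \<Rightarrow> (nat \<Rightarrow> nat \<Rightarrow> nat \<Rightarrow> bool) \<Rightarrow> nat \<Rightarrow> nat list set" where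
  "proofs R E c = {xs \<in> descents R. claim (xs ! 0) = c \<and>
     (\<forall>i. 2 * i + 2 < length xs \<longrightarrow>
       E (claim (xs ! i)) (claim (xs ! (2 * i + 1))) (claim (xs ! (2 * i + 2))))}"

lemma embeds_proofs_descents: "embeds (kb_order (proofs R E c)) (kb_order (descents R))"
  unfolding embeds_kb_order_iff by (intro exI[of _ id]) (auto simp: proofs_def)

text \<open>Every label keeps its first component and receives \<open>f i\<close> as its claim,
  where \<open>i\<close> is its position. The result obeys \<open>E\<close> because \<open>f\<close>
  does so everywhere.\<close>

lemma embeds_descents_proofs:
  fixes f :: "nat \<Rightarrow> nat"
  assumes "f 0 = c" and "\<And>i. E (f i) (f (2 * i + 1)) (f (2 * i + 2))"
  shows "embeds (kb_order (descents R)) (kb_order (proofs R E c))"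
proof -
  have "\<exists>g. strict_mono g \<and> (\<forall>e. pfst (g e) = pfst e \<and> claim (g e) = f i)" for i
    using strict_mono_label_exists[of pfst "\<lambda>_. f i" 0] by blast
  then obtain g where g: "\<And>i. strict_mono (g i)" "\<And>i e. pfst (g i e) = pfst e"
      "\<And>i e. claim (g i e) = f i"
    by metis
  let ?h = "relabel (\<lambda>us. g (length us)) []"
  show ?thesis
    unfolding embeds_kb_order_iff
  proof (intro exI[of _ ?h] conjI ballI)
    fix xs assume "xs \<in> descents R"
    then show "?h xs \<in> proofs R E c"
      using assms by (auto simp: descents_def proofs_def g min_def)
  qed (simp add: kb_relabel g(1))
qed

lemma butlast_proofs:
  assumes "xs @ [x] \<in> proofs R E c" and "xs \<noteq> []"
  shows "xs \<in> proofs R E c"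
proof -
  have "(xs @ [x]) ! i = xs ! i" if "i < length xs" for i
    using that by (simp add: nth_append)
  with assms show ?thesis
    unfolding proofs_def descents_def
    by simp (smt (verit) Suc_lessD add_Suc_right less_SucI nat_add_left_cancel_less
      add_lessD1 mult_2 add.commute plus_1_eq_Suc less_Suc_eq numeral_2_eq_2)
qed

text \<open>Writing the ranks \<open>r\<close> of the prefixes into the labels turns every attempt
  into a descent below \<open>m\<close>. Composed with a supposed embedding \<open>k\<close> this
  gives an order-preserving self-map \<open>h\<close> of the descents whose values all lie below
  \<open>[l]\<close>, against well-foundedness.\<close>

lemma not_embeds_descents_proofs:
  assumes R: "wf R"
    and r0: "\<And>x. [x] \<in> proofs R E c \<Longrightarrow> (r [x], m) \<in> R"
    and r: "\<And>xs x. xs @ [x] \<in> proofs R E c \<Longrightarrow> xs \<noteq> [] \<Longrightarrow> (r (xs @ [x]), r xs) \<in> R"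
  shows "\<not> embeds (kb_order (descents R)) (kb_order (proofs R E c))"
proof
  let ?D = "descents R"
  assume "embeds (kb_order ?D) (kb_order (proofs R E c))"
  then obtain k where k: "\<And>xs. xs \<in> ?D \<Longrightarrow> k xs \<in> proofs R E c"
    and kb_k: "\<And>xs ys. xs \<in> ?D \<Longrightarrow> ys \<in> ?D \<Longrightarrow> kb (k xs) (k ys) \<longleftrightarrow> kb xs ys"
    unfolding embeds_kb_order_iff by blast
  have "\<exists>g. strict_mono g \<and> (\<forall>e. pfst (g e) = r (us @ [e]))" for us
    using strict_mono_label_exists[of "\<lambda>e. r (us @ [e])" "\<lambda>_. 0" 0] by blast
  then obtain g where g: "\<And>us. strict_mono (g us)" "\<And>us e. pfst (g us e) = r (us @ [e])"
    by metis
  define l where "l = prod_encode (m, 0)"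
  define h where "h xs = l # relabel g [] (k xs)" for xs
  have prefix: "take (Suc i) xs \<in> proofs R E c" if "xs \<in> proofs R E c" "i < length xs" for i xs
    using that
  proof (induction xs arbitrary: i rule: rev_induct)
    case (snoc x xs)
    show ?case
    proof (cases "i < length xs")
      case True
      then have "xs \<in> proofs R E c" using butlast_proofs snoc.prems(1) by fastforce
      with snoc.IH True show ?thesis by simp
    next
      case False
      with snoc.prems show ?thesis by simp
    qed
  qed simp
  have h: "h xs \<in> ?D" if "xs \<in> ?D" for xs
  proof -
    let ?ys = "k xs"
    have ys: "?ys \<in> proofs R E c" using k that .
    then have ne: "?ys \<noteq> []" by (auto simp: proofs_def descents_def)
    have "(pfst (h xs ! Suc i), pfst (h xs ! i)) \<in> R" if i: "i < length ?ys" for i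
    proof -
      have *: "take i ?ys @ [?ys ! i] \<in> proofs R E c"
        using prefix[OF ys i] i by (simp add: take_Suc_conv_app_nth)
      show ?thesis
      proof (cases i)
        case 0
        with * i r0 show ?thesis by (simp add: h_def g l_def)
      next
        case (Suc j)
        have "take i ?ys \<noteq> []" using Suc i by auto
        with r[OF *] have "(r (take i ?ys @ [?ys ! i]), r (take i ?ys)) \<in> R" .
        moreover have "take j ?ys @ [?ys ! j] = take i ?ys"
          using Suc i by (simp add: take_Suc_conv_app_nth)
        ultimately show ?thesis using Suc i by (simp add: h_def g)
      qed
    qed
    then show ?thesis by (auto simp: descents_def h_def)
  qed
  have kb_h: "kb (h xs) (h ys) \<longleftrightarrow> kb xs ys" if "xs \<in> ?D" "ys \<in> ?D" for xs ys
    using that g(1) kb_k by (simp add: h_def kb_relabel)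
  have l: "[l] \<in> ?D" by (simp add: descents_def)
  have "k [l] \<noteq> []" using k[OF l] by (auto simp: proofs_def descents_def)
  \<comment> \<open>A proper extension precedes its prefix in \<open>kb\<close>.\<close>
  then have "kb (h [l]) [l]" by (auto simp: h_def neq_Nil_conv)
  with l have "{xs \<in> ?D. kb (h xs) xs} \<noteq> {}" by blast
  \<comment> \<open>For the least \<open>xs\<close> moved down by \<open>h\<close>, the smaller
    \<open>h xs\<close> is moved down too.\<close>
  then obtain xs where xs: "xs \<in> ?D" "kb (h xs) xs"
    and min: "\<And>ys. ys \<in> ?D \<Longrightarrow> kb (h ys) ys \<Longrightarrow> \<not> kb ys xs"
    using kb_minimal[OF R, of "{xs \<in> ?D. kb (h xs) xs}"] by blast
  from xs h kb_h have "kb (h (h xs)) (h xs)" by blast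
  with min h xs show False by blast
qed

text \<open>Used twice: the inner copy ranks claims by level and a step count, the outer one adds
  the waiting time of the pointer in \<open>false_not_embeds\<close>.\<close>

definition lex_code :: "nat rel \<Rightarrow> nat rel" where
  "lex_code Q = {(m, m'). (pfst m, pfst m') \<in> Q \<or> pfst m = pfst m' \<and> psnd m < psnd m'}"

lemma wf_lex_code:
  assumes "wf Q"
  shows "wf (lex_code Q)"
proof -
  have "lex_code Q = inv_image (Q <*lex*> less_than) (\<lambda>m. (pfst m, psnd m))"
    by (auto simp: lex_code_def)
  with assms show ?thesis by (simp add: wf_lex_prod)
qed

text \<open>\<open>ptr xs\<close> follows bad claims down the tree as long as the children are listed. Between two moves of
  the pointer the number of labels until its children appear goes down.\<close>

lemma false_not_embeds:
  assumes Q: "wf Q" and c: "bad c" "(rk c, q) \<in> Q"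
    and bad: "\<And>c c1 c2. bad c \<Longrightarrow> E c c1 c2 \<Longrightarrow>
      bad c1 \<and> (rk c1, rk c) \<in> Q \<or> bad c2 \<and> (rk c2, rk c) \<in> Q"
  shows "\<not> embeds (kb_order (descents (lex_code Q))) (kb_order (proofs (lex_code Q) E c))"
proof -
  let ?P = "proofs (lex_code Q) E c"
  \<comment> \<open>Both children of position \<open>i\<close> are listed for the first time at
    length \<open>2 * i + 3\<close>; only then does the pointer move.\<close>
  define next_ptr where "next_ptr i xs =
    (if length xs = 2 * i + 3 then
       if bad (claim (xs ! (2 * i + 1))) \<and> (rk (claim (xs ! (2 * i + 1))), rk (claim (xs ! i))) \<in> Q
       then 2 * i + 1 else 2 * i + 2 else i)" for i xs
  \<comment> \<open>Labels are appended at the end, so the recursion runs over the reversed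
    list.\<close>
  define rptr where "rptr = rec_list (0 :: nat) (\<lambda>x ys i. next_ptr i (rev (x # ys)))"
  define ptr where "ptr xs = rptr (rev xs)" for xs
  have ptr_Nil: "ptr [] = 0" and ptr_snoc: "ptr (xs @ [x]) = next_ptr (ptr xs) (xs @ [x])" for xs x
    by (simp_all add: ptr_def rptr_def)
  define r where "r xs = prod_encode (rk (claim (xs ! ptr xs)), 2 * ptr xs + 2 - length xs)" for xs
  have ptr_single: "ptr [x] = 0" for x
    using ptr_snoc[of "[]" x] by (simp add: ptr_Nil next_ptr_def)
  \<comment> \<open>The upper bound on the length makes the truncated subtraction in
    \<open>r\<close> drop strictly while the pointer rests.\<close>
  define inv where "inv xs \<longleftrightarrow> ptr xs < length xs \<and> length xs \<le> 2 * ptr xs + 2 \<and>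
    bad (claim (xs ! ptr xs))" for xs
  have step: "inv (xs @ [x]) \<and> (r (xs @ [x]), r xs) \<in> lex_code Q"
    if P: "xs @ [x] \<in> ?P" and inv: "inv xs" for xs x
  proof (cases "length xs = 2 * ptr xs + 2")
    case False
    then have "ptr (xs @ [x]) = ptr xs" by (simp add: ptr_snoc next_ptr_def)
    with inv False show ?thesis
      by (auto simp: inv_def r_def lex_code_def nth_append)
  next
    case True
    let ?i = "ptr xs" and ?xs = "xs @ [x]"
    have "E (claim (?xs ! ?i)) (claim (?xs ! (2 * ?i + 1))) (claim (?xs ! (2 * ?i + 2)))"
      using P True unfolding proofs_def by simp
    moreover have "bad (claim (?xs ! ?i))" using inv by (simp add: inv_def nth_append)
    ultimately have b: "bad (claim (?xs ! ptr ?xs)) \<and>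
        (rk (claim (?xs ! ptr ?xs)), rk (claim (?xs ! ?i))) \<in> Q"
      using bad[of "claim (?xs ! ?i)"] True by (auto simp: ptr_snoc next_ptr_def)
    moreover have "ptr ?xs = 2 * ?i + 1 \<or> ptr ?xs = 2 * ?i + 2"
      using True by (simp add: ptr_snoc next_ptr_def)
    moreover have "?xs ! ?i = xs ! ?i" using inv by (simp add: inv_def nth_append)
    ultimately show ?thesis
      using True by (auto simp: inv_def r_def lex_code_def)
  qed
  have inv: "inv xs" if "xs \<in> ?P" for xs
    using that
  proof (induction xs rule: rev_induct)
    case Nil
    then show ?case by (simp add: proofs_def descents_def)
  next
    case (snoc x xs)
    show ?case
    proof (cases "xs = []")
      case True
      with snoc.prems c show ?thesis by (auto simp: inv_def ptr_single proofs_def)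
    next
      case False
      then have "inv xs" using snoc butlast_proofs by blast
      with step snoc.prems show ?thesis by blast
    qed
  qed
  show ?thesis
  proof (rule not_embeds_descents_proofs)
    show "wf (lex_code Q)" using Q by (rule wf_lex_code)
    show "(r [x], prod_encode (q, 0)) \<in> lex_code Q" if "[x] \<in> ?P" for x
      using that c by (auto simp: r_def ptr_single lex_code_def proofs_def)
    show "(r (xs @ [x]), r xs) \<in> lex_code Q" if "xs @ [x] \<in> ?P" "xs \<noteq> []" for xs x
      using that step inv butlast_proofs by blast
  qed
qed


section \<open>A stack machine for the programs\<close>

text \<open>Configurations: \<open>ev c x k\<close> is about to run the program with code \<open>c\<close> on input \<open>x\<close>, and \<open>ret v k\<close>
  hands the value \<open>v\<close> to the stack \<open>k\<close>, where \<open>0\<close> is the empty stack. The tags of the stack frames are: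
  0 and 1 for the first and second component of a pair, 2 for a composition, 3 for a recursion and
  4 for a search. In the last two cases the loop counter is the second component of the data \<open>d\<close>.\<close>

definition ev :: "nat \<Rightarrow> nat \<Rightarrow> nat \<Rightarrow> nat" where
  "ev c x k = prod_encode (Suc c, prod_encode (x, k))"

definition ret :: "nat \<Rightarrow> nat \<Rightarrow> nat" where
  "ret v k = prod_encode (0, prod_encode (v, k))"

definition push :: "nat \<Rightarrow> nat \<Rightarrow> nat \<Rightarrow> nat \<Rightarrow> nat" where
  "push t c d k = Suc (prod_encode (prod_encode (t, prod_encode (c, d)), k))"

text \<open>Recursions are run upwards from 0: the frame keeps the whole input next to the counter,
  and the loop ends when the counter meets the depth stored in the input.\<close>

definition resume :: "nat \<Rightarrow> nat \<Rightarrow> nat \<Rightarrow> nat \<Rightarrow> nat \<Rightarrow> nat" where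
  "resume v t c d k =
    (if t = 0 then ev c d (push 1 0 v k)
     else if t = 1 then ret (prod_encode (d, v)) k
     else if t = 2 then ev c v k
     else if t = 3 then
       if psnd d = psnd (pfst d) then ret v k
       else ev c (prod_encode (pfst (pfst d), prod_encode (psnd d, v)))
         (push 3 c (prod_encode (pfst d, Suc (psnd d))) k)
     else if v = 0 then ret (psnd d) k
     else ev c (prod_encode (pfst d, Suc (psnd d))) (push 4 c (prod_encode (pfst d, Suc (psnd d))) k))"

text \<open>Inverts \<open>prog_code\<close> arithmetically: from 5 on, the remainder of
  \<open>c - 5\<close> modulo 4 is the constructor and the quotient codes its arguments.\<close>

definition eval_step :: "nat \<Rightarrow> nat \<Rightarrow> nat \<Rightarrow> nat \<Rightarrow> nat" where
  "eval_step b c x k =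
    (if c = 0 then ret 0 k
     else if c = 1 then ret (Suc x) k
     else if c = 2 then ret (pfst x) k
     else if c = 3 then ret (psnd x) k
     else if c = 4 then ret b k
     else if (c - 5) mod Suc 3 = 0 then
       ev (pfst ((c - 5) div Suc 3)) x (push 0 (psnd ((c - 5) div Suc 3)) x k)
     else if (c - 5) mod Suc 3 = 1 then
       ev (psnd ((c - 5) div Suc 3)) x (push 2 (pfst ((c - 5) div Suc 3)) 0 k)
     else if (c - 5) mod Suc 3 = 2 then
       ev (pfst ((c - 5) div Suc 3)) (pfst x) (push 3 (psnd ((c - 5) div Suc 3)) (prod_encode (x, 0)) k)
     else
       ev ((c - 5) div Suc 3) (prod_encode (x, 0)) (push 4 ((c - 5) div Suc 3) (prod_encode (x, 0)) k))"

definition frame :: "nat \<Rightarrow> nat" where "frame w = pfst (psnd (psnd w) - 1)"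

text \<open>The bit \<open>b\<close> is the answer to the oracle query; it is ignored unless the configuration
  runs \<^const>\<open>PQuery\<close>.\<close>

definition step :: "nat \<Rightarrow> nat \<Rightarrow> nat" where
  "step b w =
    (if pfst w = 0 then
       resume (pfst (psnd w)) (pfst (frame w)) (pfst (psnd (frame w))) (psnd (psnd (frame w)))
         (psnd (psnd (psnd w) - 1))
     else eval_step b (pfst w - 1) (pfst (psnd w)) (psnd (psnd w)))"

definition final :: "nat \<Rightarrow> bool" where
  "final w \<longleftrightarrow> pfst w = 0 \<and> psnd (psnd w) = 0"

text \<open>Every step asks the oracle about the current input or value, so it depends on the oracle
  through exactly one bit. That bit becomes the second premise of the machine rule in
  \<open>expands\<close>.\<close>

definition run :: "nat set \<Rightarrow> nat \<Rightarrow> nat" where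
  "run A w = step (if pfst (psnd w) \<in> A then 1 else 0) w"

lemma ucomputable_step [ucomp]:
  assumes "ucomputable F" and "ucomputable G"
  shows "ucomputable (\<lambda>A x. step (F A x) (G A x))"
  unfolding step_def resume_def eval_step_def frame_def ev_def ret_def push_def
  by (intro ucomp assms)

lemma udecidable_final [ucomp]:
  assumes "ucomputable F"
  shows "udecidable (\<lambda>A x. final (F A x))"
  unfolding final_def by (intro ucomp assms)

lemma final_ev [simp]: "\<not> final (ev c x k)"
  and final_ret [simp]: "final (ret v k) \<longleftrightarrow> k = 0"
  by (simp_all add: final_def ev_def ret_def)

lemma push_neq_0 [simp]: "push t c d k \<noteq> 0"
  by (simp add: push_def)

lemma run_ev: "run A (ev c x k) = eval_step (if x \<in> A then 1 else 0) c x k"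
  by (simp add: run_def step_def ev_def)

declare prog_code.simps [simp del]

lemma prog_code_div_mod:
  "(5 + 4 * q - 5) mod Suc 3 = 0" "(5 + 4 * q - 5) div Suc 3 = q"
  "(6 + 4 * q - 5) mod Suc 3 = 1" "(6 + 4 * q - 5) div Suc 3 = q"
  "(7 + 4 * q - 5) mod Suc 3 = 2" "(7 + 4 * q - 5) div Suc 3 = q"
  "(8 + 4 * q - 5) mod Suc 3 = 3" "(8 + 4 * q - 5) div Suc 3 = q"
  for q :: nat
  by (simp_all, presburger+)

lemma run_ev_prog_code [simp]:
  "run A (ev (prog_code PZero) x k) = ret 0 k"
  "run A (ev (prog_code PSucc) x k) = ret (Suc x) k"
  "run A (ev (prog_code PFst) x k) = ret (pfst x) k"
  "run A (ev (prog_code PSnd) x k) = ret (psnd x) k"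
  "run A (ev (prog_code PQuery) x k) = ret (if x \<in> A then 1 else 0) k"
  "run A (ev (prog_code (PPair f g)) x k) = ev (prog_code f) x (push 0 (prog_code g) x k)"
  "run A (ev (prog_code (PComp f g)) x k) = ev (prog_code g) x (push 2 (prog_code f) 0 k)"
  "run A (ev (prog_code (PRec f g)) x k) =
     ev (prog_code f) (pfst x) (push 3 (prog_code g) (prod_encode (x, 0)) k)"
  "run A (ev (prog_code (PMu f)) x k) =
     ev (prog_code f) (prod_encode (x, 0)) (push 4 (prog_code f) (prod_encode (x, 0)) k)"
  by (simp_all only: run_ev eval_step_def prog_code.simps prog_code_div_mod) simp_all

lemma run_ret_push [simp]: "run A (ret v (push t c d k)) = resume v t c d k"
  by (simp add: run_def step_def frame_def ret_def push_def)

section \<open>Agreement of the machine with \<open>computes\<close>\<close>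

definition reaches :: "nat set \<Rightarrow> nat \<Rightarrow> nat \<Rightarrow> bool" where
  "reaches A w w' \<longleftrightarrow> (\<exists>t. (run A ^^ t) w = w')"

lemma reaches_trans [trans]: "reaches A u v \<Longrightarrow> reaches A v w \<Longrightarrow> reaches A u w"
  unfolding reaches_def by (metis funpow_add comp_apply add.commute)

lemma reaches_run: "run A u = v \<Longrightarrow> reaches A u v"
  unfolding reaches_def by (intro exI[of _ 1]) simp

lemma reaches_step: "reaches A (run A u) w \<Longrightarrow> reaches A u w"
  using reaches_trans reaches_run by blast

lemma reaches_refl: "reaches A u u"
  unfolding reaches_def by (metis funpow_0)

lemma computes_reaches:
  assumes "computes A e x y"
  shows "reaches A (ev (prog_code e) x k) (ret y k)"
proof -
  \<comment> \<open>A derivation for \<open>PRec\<close> concerns one stage, while the machine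
    carries the full depth \<open>N\<close> in its frame. The second conjunct says that the loop for
    any sufficient \<open>N\<close> passes through this stage with the right value.\<close>
  have "(\<forall>k. reaches A (ev (prog_code e) x k) (ret y k)) \<and>
    (\<forall>f g k N. e = PRec f g \<longrightarrow> psnd x \<le> N \<longrightarrow>
       reaches A (ev (prog_code e) (prod_encode (pfst x, N)) k)
         (ret y (push 3 (prog_code g) (prod_encode (prod_encode (pfst x, N), psnd x)) k)))"
    using assms
  proof (induction rule: computes.induct)
    case (pair f x y g z)
    have "reaches A (ev (prog_code (PPair f g)) x k) (ret (prod_encode (y, z)) k)" for k
    proof -
      have "reaches A (ev (prog_code (PPair f g)) x k) (ret y (push 0 (prog_code g) x k))"
        by (rule reaches_step) (use pair in simp)
      also have "reaches A \<dots> (ret z (push 1 0 y k))"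
        by (rule reaches_step) (use pair in \<open>auto simp: resume_def\<close>)
      also have "reaches A \<dots> (ret (prod_encode (y, z)) k)"
        by (rule reaches_run) (simp add: resume_def)
      finally show ?thesis .
    qed
    then show ?case by simp
  next
    case (comp g x y f z)
    have "reaches A (ev (prog_code (PComp f g)) x k) (ret z k)" for k
    proof -
      have "reaches A (ev (prog_code (PComp f g)) x k) (ret y (push 2 (prog_code f) 0 k))"
        by (rule reaches_step) (use comp in simp)
      also have "reaches A \<dots> (ret z k)"
        by (rule reaches_step) (use comp in \<open>auto simp: resume_def\<close>)
      finally show ?thesis .
    qed
    then show ?case by simp
  next
    case (rec_0 f x y g)
    have *: "reaches A (ev (prog_code (PRec f g)) (prod_encode (x, N)) k)
      (ret y (push 3 (prog_code g) (prod_encode (prod_encode (x, N), 0)) k))" for N k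
      by (rule reaches_step) (use rec_0 in simp)
    have "reaches A (ev (prog_code (PRec f g)) (prod_encode (x, 0)) k) (ret y k)" for k
      by (rule reaches_trans[OF *]) (simp_all add: reaches_run resume_def)
    with * show ?case by simp
  next
    case (rec_Suc f g x n y z)
    have *: "reaches A (ev (prog_code (PRec f g)) (prod_encode (x, N)) k)
      (ret z (push 3 (prog_code g) (prod_encode (prod_encode (x, N), Suc n)) k))" if "Suc n \<le> N" for N k
    proof -
      have "reaches A (ev (prog_code (PRec f g)) (prod_encode (x, N)) k)
        (ret y (push 3 (prog_code g) (prod_encode (prod_encode (x, N), n)) k))"
        using rec_Suc.IH(1) that by simp
      also have "reaches A \<dots> (ret z (push 3 (prog_code g) (prod_encode (prod_encode (x, N), Suc n)) k))"
        by (rule reaches_step) (use that rec_Suc.IH(2) in \<open>auto simp: resume_def\<close>)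
      finally show ?thesis .
    qed
    have "reaches A (ev (prog_code (PRec f g)) (prod_encode (x, Suc n)) k) (ret z k)" for k
      by (rule reaches_trans[OF *]) (simp_all add: reaches_run resume_def)
    with * show ?case by simp
  next
    case (mu f x n)
    have *: "reaches A (ev (prog_code f) (prod_encode (x, 0)) (push 4 (prog_code f) (prod_encode (x, 0)) k))
      (ev (prog_code f) (prod_encode (x, m)) (push 4 (prog_code f) (prod_encode (x, m)) k))"
      if "m \<le> n" for m k
      using that
    proof (induction m)
      case 0
      show ?case by (rule reaches_refl)
    next
      case (Suc m)
      let ?k = "push 4 (prog_code f) (prod_encode (x, m)) k"
      from Suc mu.IH obtain v where "reaches A (ev (prog_code f) (prod_encode (x, m)) ?k) (ret (Suc v) ?k)"
        by (meson Suc_le_eq)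
      also have "reaches A \<dots> (ev (prog_code f) (prod_encode (x, Suc m))
          (push 4 (prog_code f) (prod_encode (x, Suc m)) k))"
        by (rule reaches_run) (simp add: resume_def)
      finally have "reaches A (ev (prog_code f) (prod_encode (x, m)) ?k) (ev (prog_code f)
        (prod_encode (x, Suc m)) (push 4 (prog_code f) (prod_encode (x, Suc m)) k))" .
      with Suc.IH[OF Suc_leD[OF Suc.prems]] show ?case by (rule reaches_trans)
    qed
    have "reaches A (ev (prog_code (PMu f)) x k) (ret n k)" for k
    proof -
      have "reaches A (ev (prog_code (PMu f)) x k)
          (ev (prog_code f) (prod_encode (x, n)) (push 4 (prog_code f) (prod_encode (x, n)) k))"
        by (rule reaches_step) (use * in simp)
      also have "reaches A \<dots> (ret 0 (push 4 (prog_code f) (prod_encode (x, n)) k))"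
        using mu.IH by blast
      also have "reaches A \<dots> (ret n k)"
        by (rule reaches_run) (simp add: resume_def)
      finally show ?thesis .
    qed
    then show ?case by simp
  qed (simp_all add: reaches_run)
  then show ?thesis by blast
qed

text \<open>A final configuration is not a fixed point of \<open>run\<close>, so \<open>t\<close> is
  the exact time of a final configuration, not a bound for it.\<close>

definition halts_in :: "nat set \<Rightarrow> nat \<Rightarrow> nat \<Rightarrow> bool" where
  "halts_in A t w \<longleftrightarrow> final ((run A ^^ t) w)"

lemma halts_in_0 [simp]: "halts_in A 0 w \<longleftrightarrow> final w"
  by (simp add: halts_in_def)

lemma halts_in_Suc [simp]: "halts_in A (Suc t) w \<longleftrightarrow> halts_in A t (run A w)"
  by (simp add: halts_in_def funpow_swap1)

lemma halts_in_notfinal: "halts_in A t w \<Longrightarrow> \<not> final w \<Longrightarrow> \<exists>t'<t. halts_in A t' (run A w)"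
  by (cases t) auto

text \<open>A run can become final only after handing a value to the stack \<open>k\<close>. The
  rest of the run is strictly shorter, so induction on the time covers the subprograms one after the
  other.\<close>

lemma halts_in_computes:
  assumes "halts_in A t (ev (prog_code e) x k)"
  shows "\<exists>y t'. t' < t \<and> computes A e x y \<and> halts_in A t' (ret y k)"
  using assms
proof (induction t arbitrary: e x k rule: less_induct)
  case (less t)
  from halts_in_notfinal[OF less.prems] obtain s
    where s: "s < t" "halts_in A s (run A (ev (prog_code e) x k))" by auto
  have ret_step: "\<exists>t'<t. halts_in A t' (resume v u c d k)"
    if "halts_in A t (ret v (push u c d k))" for t v u c d k
    using halts_in_notfinal[OF that] by auto
  show ?case
  proof (cases e)
    case PZero
    have "computes A e x (0)" unfolding PZero by (rule computes.zero)
    moreover have "halts_in A s (ret (0) k)" using s(2) by (simp only: PZero run_ev_prog_code)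
    ultimately show ?thesis using s(1) by blast
  next
    case PSucc
    have "computes A e x (Suc x)" unfolding PSucc by (rule computes.succ)
    moreover have "halts_in A s (ret (Suc x) k)" using s(2) by (simp only: PSucc run_ev_prog_code)
    ultimately show ?thesis using s(1) by blast
  next
    case PFst
    have "computes A e x (pfst x)" unfolding PFst by (metis computes.fst prod_encode_pfst_psnd)
    moreover have "halts_in A s (ret (pfst x) k)" using s(2) by (simp only: PFst run_ev_prog_code)
    ultimately show ?thesis using s(1) by blast
  next
    case PSnd
    have "computes A e x (psnd x)" unfolding PSnd by (metis computes.snd prod_encode_pfst_psnd)
    moreover have "halts_in A s (ret (psnd x) k)" using s(2) by (simp only: PSnd run_ev_prog_code)
    ultimately show ?thesis using s(1) by blast
  next
    case PQuery
    have "computes A e x (if x \<in> A then 1 else 0)" unfolding PQuery by (rule computes.query)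
    moreover have "halts_in A s (ret (if x \<in> A then 1 else 0) k)" using s(2) by (simp only: PQuery run_ev_prog_code)
    ultimately show ?thesis using s(1) by blast
  next
    case (PPair f g)
    have "halts_in A s (ev (prog_code f) x (push 0 (prog_code g) x k))" using s by (simp add: PPair)
    from less.IH[OF s(1) this] obtain y t1 where y: "t1 < s" "computes A f x y"
      "halts_in A t1 (ret y (push 0 (prog_code g) x k))" by auto
    from ret_step[OF y(3)] obtain t2 where t2: "t2 < t1"
      "halts_in A t2 (ev (prog_code g) x (push 1 0 y k))" by (auto simp: resume_def)
    with s y less.IH[OF _ t2(2)] obtain z t3 where z: "t3 < t2" "computes A g x z"
      "halts_in A t3 (ret z (push 1 0 y k))" by auto
    from ret_step[OF z(3)] obtain t4 where "t4 < t3" "halts_in A t4 (ret (prod_encode (y, z)) k)"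
      by (auto simp: resume_def)
    moreover have "computes A e x (prod_encode (y, z))"
      unfolding PPair using y z by (intro computes.pair)
    moreover from calculation have "t4 < t" using s(1) y(1) t2(1) z(1) by simp
    ultimately show ?thesis by blast
  next
    case (PComp f g)
    have "halts_in A s (ev (prog_code g) x (push 2 (prog_code f) 0 k))" using s by (simp add: PComp)
    from less.IH[OF s(1) this] obtain y t1 where y: "t1 < s" "computes A g x y"
      "halts_in A t1 (ret y (push 2 (prog_code f) 0 k))" by auto
    from ret_step[OF y(3)] obtain t2 where t2: "t2 < t1"
      "halts_in A t2 (ev (prog_code f) y k)" by (auto simp: resume_def)
    with s y less.IH[OF _ t2(2)] obtain z t3 where z: "t3 < t2" "computes A f y z"
      "halts_in A t3 (ret z k)" by auto
    moreover have "computes A e x z"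
      unfolding PComp using y z by (intro computes.comp)
    moreover from calculation have "t3 < t" using s(1) y(1) t2(1) by simp
    ultimately show ?thesis by blast
  next
    case (PRec f g)
    obtain a N where x: "x = prod_encode (a, N)" by (metis prod_encode_pfst_psnd)
    \<comment> \<open>Induction on the number of stages left; \<open>r < t\<close> keeps the outer
      hypothesis available for the step program.\<close>
    have loop: "\<exists>y t'. t' < r \<and> computes A e x y \<and> halts_in A t' (ret y k)"
      if "halts_in A r (ret v (push 3 (prog_code g) (prod_encode (x, i)) k))" "r < t"
        "computes A e (prod_encode (a, i)) v" "i \<le> N" for r i v
      using that
    proof (induction "N - i" arbitrary: i r v rule: less_induct)
      case IH: less
      show ?case
      proof (cases "i = N")
        case True
        with ret_step[OF IH.prems(1)] obtain r' where "r' < r" "halts_in A r' (ret v k)"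
          by (auto simp: resume_def x)
        with IH.prems(3) True x show ?thesis by auto
      next
        case False
        with ret_step[OF IH.prems(1)] obtain r1 where r1: "r1 < r"
          "halts_in A r1 (ev (prog_code g) (prod_encode (a, prod_encode (i, v)))
             (push 3 (prog_code g) (prod_encode (x, Suc i)) k))"
          by (auto simp: resume_def x)
        with IH.prems less.IH[OF _ r1(2)] obtain z r2 where z: "r2 < r1"
          "computes A g (prod_encode (a, prod_encode (i, v))) z"
          "halts_in A r2 (ret z (push 3 (prog_code g) (prod_encode (x, Suc i)) k))"
          by auto
        have "computes A e (prod_encode (a, Suc i)) z"
          using IH.prems(3) z(2) unfolding PRec by (rule computes.rec_Suc)
        moreover have "N - Suc i < N - i" "r2 < t" "Suc i \<le> N"
          using False IH.prems r1 z by auto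
        ultimately obtain y t' where "t' < r2" "computes A e x y" "halts_in A t' (ret y k)"
          using IH.hyps[of "Suc i" r2 z] z(3) by blast
        moreover from this have "t' < r" using z(1) r1(1) by simp
        ultimately show ?thesis by blast
      qed
    qed
    have "halts_in A s (ev (prog_code f) a (push 3 (prog_code g) (prod_encode (x, 0)) k))" using s by (simp add: PRec x)
    from less.IH[OF s(1) this] obtain y t1 where y: "t1 < s" "computes A f a y"
      "halts_in A t1 (ret y (push 3 (prog_code g) (prod_encode (x, 0)) k))" by auto
    have "computes A e (prod_encode (a, 0)) y"
      using y(2) unfolding PRec by (rule computes.rec_0)
    from loop[OF y(3) less_trans[OF y(1) s(1)] this] obtain y' t'
      where "t' < t1" "computes A e x y'" "halts_in A t' (ret y' k)" by auto
    moreover from this have "t' < t" using y(1) s(1) by simp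
    ultimately show ?thesis by blast
  next
    case (PMu f)
    \<comment> \<open>The number of rounds of a search is not known beforehand, so the remaining
      time \<open>r\<close> is the induction measure.\<close>
    have loop: "\<exists>y t'. t' < r \<and> computes A e x y \<and> halts_in A t' (ret y k)"
      if "halts_in A r (ev (prog_code f) (prod_encode (x, i)) (push 4 (prog_code f) (prod_encode (x, i)) k))"
        "r < t" "\<forall>m<i. \<exists>v. computes A f (prod_encode (x, m)) (Suc v)" for r i
      using that
    proof (induction r arbitrary: i rule: less_induct)
      case IH: (less r)
      from IH.prems less.IH[OF _ IH.prems(1)] obtain v r1 where v: "r1 < r"
        "computes A f (prod_encode (x, i)) v"
        "halts_in A r1 (ret v (push 4 (prog_code f) (prod_encode (x, i)) k))" by auto
      show ?case
      proof (cases v)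
        case 0
        with ret_step[OF v(3)] obtain r2 where "r2 < r1" "halts_in A r2 (ret i k)"
          by (auto simp: resume_def)
        moreover have "computes A e x i"
          unfolding PMu using v(2) IH.prems(3) 0 by (intro computes.mu) auto
        moreover from calculation have "r2 < r" using v(1) by simp
        ultimately show ?thesis by blast
      next
        case (Suc v')
        with ret_step[OF v(3)] obtain r2 where r2: "r2 < r1" "halts_in A r2
          (ev (prog_code f) (prod_encode (x, Suc i)) (push 4 (prog_code f) (prod_encode (x, Suc i)) k))"
          by (auto simp: resume_def)
        have "\<forall>m<Suc i. \<exists>v. computes A f (prod_encode (x, m)) (Suc v)"
          using IH.prems(3) v(2) Suc by (auto simp: less_Suc_eq)
        from IH.IH[OF _ r2(2) _ this] obtain y t'
          where "t' < r2" "computes A e x y" "halts_in A t' (ret y k)"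
          using r2(1) v(1) IH.prems(2) by auto
        moreover from this have "t' < r" using r2(1) v(1) by simp
        ultimately show ?thesis by blast
      qed
    qed
    have "halts_in A s (ev (prog_code f) (prod_encode (x, 0)) (push 4 (prog_code f) (prod_encode (x, 0)) k))"
      using s by (simp add: PMu)
    from loop[OF this s(1)] obtain y t'
      where "t' < s" "computes A e x y" "halts_in A t' (ret y k)" by auto
    moreover from this have "t' < t" using s(1) by simp
    ultimately show ?thesis by blast
  qed
qed

text \<open>Every number codes a program, so membership in the jump is halting of the machine
  started on \<open>n\<close> with the empty stack.\<close>

lemma turing_jump_iff: "n \<in> turing_jump A \<longleftrightarrow> (\<exists>t. halts_in A t (ev n n 0))"
proof -
  obtain e where n: "n = prog_code e" using bij_prog_code by (metis bij_pointE)
  have "n \<in> turing_jump A \<longleftrightarrow> (\<exists>y. computes A e n y)"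
    by (auto simp: turing_jump_def n inj_eq[OF bij_is_inj[OF bij_prog_code]])
  also have "\<dots> \<longleftrightarrow> (\<exists>t. halts_in A t (ev n n 0))"
  proof
    assume "\<exists>y. computes A e n y"
    then obtain y where "reaches A (ev n n 0) (ret y 0)"
      using computes_reaches n by blast
    then show "\<exists>t. halts_in A t (ev n n 0)"
      unfolding reaches_def halts_in_def by (metis final_ret)
  next
    assume "\<exists>t. halts_in A t (ev n n 0)"
    then show "\<exists>y. computes A e n y" using halts_in_computes n by blast
  qed
  finally show ?thesis .
qed


section \<open>Claims and their proofs\<close>

fun tree_label :: "(nat \<Rightarrow> nat) \<Rightarrow> (nat \<Rightarrow> nat) \<Rightarrow> nat \<Rightarrow> nat \<Rightarrow> nat" where
  "tree_label l r c n = (if n = 0 then c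
     else if odd n then l (tree_label l r c ((n - 1) div 2))
     else r (tree_label l r c ((n - 2) div 2)))"

declare tree_label.simps [simp del]

text \<open>Turns local justification into an infinite proof: choice functions for the two children,
  iterated along the heap, never leave \<open>P\<close>.\<close>

lemma labelling_exists:
  fixes c :: nat
  assumes c: "P c" and ex: "\<And>c. P c \<Longrightarrow> \<exists>c1 c2. E c c1 c2 \<and> P c1 \<and> P c2"
  shows "\<exists>f :: nat \<Rightarrow> nat. f 0 = c \<and> (\<forall>i. E (f i) (f (2 * i + 1)) (f (2 * i + 2)))"
proof -
  from ex obtain l r where lr: "\<And>c. P c \<Longrightarrow> E c (l c) (r c) \<and> P (l c) \<and> P (r c)"
    by metis
  let ?f = "tree_label l r c"
  have children: "?f (2 * i + 1) = l (?f i)" "?f (2 * i + 2) = r (?f i)" for i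
    by (subst tree_label.simps, simp)+
  have "P (?f n)" for n
  proof (induction n rule: less_induct)
    case (less n)
    have "n = 0 \<or> (\<exists>i. n = 2 * i + 1) \<or> (\<exists>i. n = 2 * i + 2)" by presburger
    then consider "n = 0" | i where "n = 2 * i + 1" | i where "n = 2 * i + 2" by blast
    then show ?case
    proof cases
      case 1
      then show ?thesis using c by (simp add: tree_label.simps)
    next
      case (2 i)
      then show ?thesis using less.IH[of i] lr children by simp
    next
      case (3 i)
      then show ?thesis using less.IH[of i] lr children by simp
    qed
  qed
  with lr children have "E (?f i) (?f (2 * i + 1)) (?f (2 * i + 2))" for i by simp
  moreover have "?f 0 = c" by (simp add: tree_label.simps)
  ultimately show ?thesis by blast
qed

section \<open>Reading the code of a labeled well-ordering\<close>

lemma join_even [simp]: "2 * n \<in> A \<oplus> B \<longleftrightarrow> n \<in> A"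
  and join_odd [simp]: "Suc (2 * n) \<in> A \<oplus> B \<longleftrightarrow> n \<in> B"
proof -
  have "2 * n = sum_encode (Inl n)" "Suc (2 * n) = sum_encode (Inr n)"
    by (simp_all add: sum_encode_def)
  then show "2 * n \<in> A \<oplus> B \<longleftrightarrow> n \<in> A" "Suc (2 * n) \<in> A \<oplus> B \<longleftrightarrow> n \<in> B"
    unfolding join_def by (simp_all only: inj_image_mem_iff[OF inj_sum_encode]) auto
qed

lemma big_join_iff: "n \<in> big_join I Y \<longleftrightarrow> pfst n \<in> I \<and> psnd n \<in> Y (pfst n)"
proof -
  have "n \<in> big_join I Y \<longleftrightarrow> (pfst n, psnd n) \<in> (SIGMA i:I. Y i)"
    unfolding big_join_def
    by (metis inj_image_mem_iff inj_prod_encode prod_encode_pfst_psnd)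
  then show ?thesis by simp
qed

lemma order_code_iff: "n \<in> order_code r \<longleftrightarrow> (pfst n, psnd n) \<in> r"
  unfolding order_code_def
  by (metis inj_image_mem_iff inj_prod_encode prod_encode_pfst_psnd)

text \<open>This and the next three tests read the summands of the right-nested join in
  \<open>lwo_code\<close>. Each is a single oracle question, meaningful for every
  \<open>X\<close>.\<close>

definition le_of :: "nat set \<Rightarrow> nat \<Rightarrow> nat \<Rightarrow> bool" where
  "le_of X a b \<longleftrightarrow> 2 * prod_encode (a, b) \<in> X"

definition least_of :: "nat set \<Rightarrow> nat \<Rightarrow> bool" where
  "least_of X a \<longleftrightarrow> Suc (2 * (2 * a)) \<in> X"

definition successor_of :: "nat set \<Rightarrow> nat \<Rightarrow> bool" where
  "successor_of X a \<longleftrightarrow> Suc (2 * Suc (2 * (2 * a))) \<in> X"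

definition pred_of :: "nat set \<Rightarrow> nat \<Rightarrow> nat \<Rightarrow> bool" where
  "pred_of X b a \<longleftrightarrow> Suc (2 * Suc (2 * Suc (2 * prod_encode (b, a)))) \<in> X"

lemma lwo_code_sel [simp]:
  "le_of (lwo_code L z S p) a b \<longleftrightarrow> (a, b) \<in> L"
  "least_of (lwo_code L z S p) a \<longleftrightarrow> a = z"
  "successor_of (lwo_code L z S p) a \<longleftrightarrow> a \<in> S"
  "pred_of (lwo_code L z S p) b a \<longleftrightarrow> b \<in> S \<and> a = p b"
  unfolding le_of_def least_of_def successor_of_def pred_of_def lwo_code_def join_even join_odd
  by (auto simp: order_code_iff)

text \<open>\<open>claim_mem s a n\<close> says \<open>n \<in> Y a\<close> if \<open>s \<noteq> 0\<close> and \<open>n \<notin> Y a\<close> if \<open>s = 0\<close>. \<open>claim_run s a w\<close> says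
  that \<open>w\<close> never halts with oracle \<open>Y a\<close> if \<open>s = 0\<close>, and halts in fewer than \<open>s\<close> steps otherwise.
  The claim \<open>0\<close> is trivially true.\<close>

definition claim_mem :: "nat \<Rightarrow> nat \<Rightarrow> nat \<Rightarrow> nat" where
  "claim_mem s a n = prod_encode (1, prod_encode (a, prod_encode (s, n)))"

definition claim_run :: "nat \<Rightarrow> nat \<Rightarrow> nat \<Rightarrow> nat" where
  "claim_run s a w = prod_encode (2, prod_encode (a, prod_encode (s, w)))"

definition level :: "nat \<Rightarrow> nat" where "level c = pfst (psnd c)"
definition param :: "nat \<Rightarrow> nat" where "param c = pfst (psnd (psnd c))"
definition arg :: "nat \<Rightarrow> nat" where "arg c = psnd (psnd (psnd c))"

lemma claim_sel [simp]:
  "pfst (claim_mem s a n) = 1" "level (claim_mem s a n) = a"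
  "param (claim_mem s a n) = s" "arg (claim_mem s a n) = n"
  "pfst (claim_run s a w) = 2" "level (claim_run s a w) = a"
  "param (claim_run s a w) = s" "arg (claim_run s a w) = w"
  by (simp_all add: claim_mem_def claim_run_def level_def param_def arg_def)

definition expands :: "nat set \<Rightarrow> nat \<Rightarrow> nat \<Rightarrow> nat \<Rightarrow> bool" where
  "expands X c c1 c2 \<longleftrightarrow>
    (if pfst c = 0 then c1 = 0 \<and> c2 = 0
     else if pfst c = 1 then
       c2 = 0 \<and>
       (if least_of X (level c) then c1 = 0 \<and> (if arg c \<in> X then param c \<noteq> 0 else param c = 0)
        else if successor_of X (level c) then
          c1 = claim_run (param c1) (level c1) (ev (arg c) (arg c) 0) \<and>
          pred_of X (level c) (level c1) \<and> (if param c = 0 then param c1 = 0 else param c1 \<noteq> 0)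
        else if le_of X (pfst (arg c)) (level c) \<and> pfst (arg c) \<noteq> level c then
          c1 = claim_mem (param c) (pfst (arg c)) (psnd (arg c))
        else c1 = 0 \<and> param c = 0)
     else if final (arg c) then c1 = 0 \<and> c2 = 0 \<and> param c \<noteq> 0
     else param c \<noteq> 1 \<and>
       (\<exists>b<2. c1 = claim_run (param c - 1) (level c) (step b (arg c)) \<and>
         c2 = claim_mem b (level c) (pfst (psnd (arg c)))))"

section \<open>Truth and ranks of claims over a jump hierarchy\<close>

locale hierarchy =
  fixes L :: "nat rel" and z :: nat and S :: "nat set" and p :: "nat \<Rightarrow> nat"
    and Y :: "nat \<Rightarrow> nat set"
  assumes lwo: "labeled_well_ordering L z S p" and jh: "jump_hierarchy L z S p Y"
begin

abbreviation code :: "nat set" where "code \<equiv> lwo_code L z S p"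

lemma Y_z: "Y z = code"
  using jh by (simp add: jump_hierarchy_def)

lemma Y_successor:
  assumes "a \<in> S"
  shows "Y a = turing_jump (Y (p a))" and "p a \<in> Field L" and "(p a, a) \<in> L - Id"
proof -
  have "covers L (p a) a" using lwo assms by (simp add: labeled_well_ordering_def)
  with jh show "Y a = turing_jump (Y (p a))" "p a \<in> Field L" "(p a, a) \<in> L - Id"
    by (auto simp: jump_hierarchy_def covers_def intro: FieldI1)
qed

lemma Y_limit:
  assumes "a \<in> Field L" "a \<noteq> z" "a \<notin> S"
  shows "n \<in> Y a \<longleftrightarrow> (pfst n, a) \<in> L \<and> pfst n \<noteq> a \<and> psnd n \<in> Y (pfst n)"
proof -
  have "Y a = big_join (underS L a) Y"
    using lwo jh assms by (auto simp: labeled_well_ordering_def jump_hierarchy_def)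
  then show ?thesis by (auto simp: big_join_iff underS_def)
qed

definition holds :: "nat \<Rightarrow> bool" where
  "holds c \<longleftrightarrow>
    (if pfst c = 0 then True
     else if pfst c = 1 then param c \<noteq> 0 \<longleftrightarrow> arg c \<in> Y (level c)
     else if param c = 0 then \<forall>t. \<not> halts_in (Y (level c)) t (arg c)
     else \<exists>t<param c. halts_in (Y (level c)) t (arg c))"

definition bad :: "nat \<Rightarrow> bool" where
  "bad c \<longleftrightarrow> \<not> holds c \<and> level c \<in> Field L"

text \<open>Membership claims come below all machine claims of their level, because a machine rule
  asks for an oracle bit at its own level. False divergence is measured by the true halting time, a
  halting claim by its bound; both drop with a machine step.\<close>

definition rank :: "nat \<Rightarrow> nat" where
  "rank c = prod_encode (level c,
     if pfst c = 1 then 0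
     else Suc (if param c = 0 then LEAST t. halts_in (Y (level c)) t (arg c) else param c))"

lemma holds_0 [simp]: "holds 0" by (simp add: holds_def)

lemma holds_mem [simp]: "holds (claim_mem s a n) \<longleftrightarrow> (s \<noteq> 0 \<longleftrightarrow> n \<in> Y a)"
  by (simp add: holds_def)

lemma holds_run [simp]:
  "holds (claim_run s a w) \<longleftrightarrow>
    (if s = 0 then \<forall>t. \<not> halts_in (Y a) t w else \<exists>t<s. halts_in (Y a) t w)"
  by (simp add: holds_def)

text \<open>Supplies the children for \<open>labelling_exists\<close>. The condition on levels is
  carried along because \<open>Y\<close> is constrained on the field of \<open>L\<close>
  only.\<close>

lemma holds_expands:
  assumes c: "holds c" and valid: "pfst c = 0 \<or> level c \<in> Field L"
  shows "\<exists>c1 c2. expands code c c1 c2 \<and> (holds c1 \<and> (pfst c1 = 0 \<or> level c1 \<in> Field L)) \<and>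
    (holds c2 \<and> (pfst c2 = 0 \<or> level c2 \<in> Field L))"
proof -
  let ?a = "level c" and ?s = "param c" and ?n = "arg c"
  consider "pfst c = 0" | "pfst c = 1" | "pfst c \<noteq> 0" "pfst c \<noteq> 1" by blast
  then show ?thesis
  proof cases
    case 1
    then show ?thesis by (intro exI[of _ 0]) (simp add: expands_def)
  next
    case 2
    with c have c: "?s \<noteq> 0 \<longleftrightarrow> ?n \<in> Y ?a" by (simp add: holds_def)
    from 2 valid have a: "?a \<in> Field L" by simp
    consider "?a = z" | "?a \<noteq> z" "?a \<in> S" | "?a \<noteq> z" "?a \<notin> S" by blast
    then show ?thesis
    proof cases
      case 1
      with 2 c show ?thesis
        by (intro exI[of _ 0]) (auto simp: expands_def Y_z)
    next
      case *: 2
      \<comment> \<open>The guess is 0 for divergence and \<open>Suc t\<close> for halting at time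
        \<open>t\<close>, since the bound in a claim is strict.\<close>
      have "\<exists>s'. (?s = 0 \<longleftrightarrow> s' = 0) \<and> holds (claim_run s' (p ?a) (ev ?n ?n 0))"
      proof (cases "?s = 0")
        case True
        with c * show ?thesis
          by (intro exI[of _ 0]) (auto simp: Y_successor turing_jump_iff)
      next
        case False
        with c * obtain t where "halts_in (Y (p ?a)) t (ev ?n ?n 0)"
          by (auto simp: Y_successor turing_jump_iff)
        with False show ?thesis by (intro exI[of _ "Suc t"]) auto
      qed
      then obtain s' where "(?s = 0 \<longleftrightarrow> s' = 0) \<and> holds (claim_run s' (p ?a) (ev ?n ?n 0))" ..
      with 2 * Y_successor(2)[OF *(2)] show ?thesis
        by (intro exI[of _ "claim_run s' (p ?a) (ev ?n ?n 0)"] exI[of _ 0])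
          (simp add: expands_def del: holds_run)
    next
      case 3
      show ?thesis
      proof (cases "(pfst ?n, ?a) \<in> L \<and> pfst ?n \<noteq> ?a")
        case True
        with 2 3 c a show ?thesis
          by (intro exI[of _ "claim_mem ?s (pfst ?n) (psnd ?n)"] exI[of _ 0])
            (auto simp: expands_def Y_limit intro: FieldI1)
      next
        case False
        with 2 3 c a show ?thesis
          by (intro exI[of _ 0]) (auto simp: expands_def Y_limit)
      qed
    qed
  next
    case 3
    show ?thesis
    proof (cases "final ?n")
      case True
      with 3 c have "?s \<noteq> 0" by (auto simp: holds_def split: if_splits) (metis halts_in_0)
      with 3 True show ?thesis by (intro exI[of _ 0]) (simp add: expands_def)
    next
      case False
      \<comment> \<open>With the true oracle bit the second premise holds and \<open>step b\<close>
        is the true machine step.\<close>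
      define b where "b = (if pfst (psnd ?n) \<in> Y ?a then 1 else 0 :: nat)"
      let ?c1 = "claim_run (?s - 1) ?a (step b ?n)" and ?c2 = "claim_mem b ?a (pfst (psnd ?n))"
      have step: "step b ?n = run (Y ?a) ?n" by (simp add: run_def b_def)
      have "?s \<noteq> 1 \<and> holds ?c1"
      proof (cases "?s = 0")
        case True
        with 3 c have "\<not> halts_in (Y ?a) (Suc t) ?n" for t by (simp add: holds_def del: halts_in_Suc)
        with True show ?thesis by (simp add: step)
      next
        case s: False
        with 3 c obtain t where t: "t < ?s" "halts_in (Y ?a) t ?n" by (auto simp: holds_def)
        with False obtain t' where "t = Suc t'" "halts_in (Y ?a) t' (run (Y ?a) ?n)"
          by (cases t) auto
        with t show ?thesis by (auto simp: step intro!: exI[of _ t'])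
      qed
      moreover have "holds ?c2" "b < 2" by (auto simp: b_def)
      ultimately show ?thesis
        using 3 False valid
        by (intro exI[of _ ?c1] exI[of _ ?c2]) (auto simp: expands_def simp del: holds_run holds_mem)
    qed
  qed
qed

text \<open>A false membership claim passes its falsity to a lower level. For a false machine claim
  either the guessed oracle bit is wrong, or the step is the true one and the claim about the next
  configuration is false.\<close>

lemma bad_expands:
  assumes c: "bad c" and c12: "expands code c c1 c2"
  shows "bad c1 \<and> (rank c1, rank c) \<in> lex_code (L - Id) \<or>
    bad c2 \<and> (rank c2, rank c) \<in> lex_code (L - Id)"
proof -
  let ?a = "level c" and ?s = "param c" and ?n = "arg c"
  have a: "?a \<in> Field L" and nh: "\<not> holds c" using c by (auto simp: bad_def)
  then have "pfst c \<noteq> 0" by (cases "pfst c = 0") (simp_all add: holds_def)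
  then consider "pfst c = 1" | "pfst c \<noteq> 0" "pfst c \<noteq> 1" by blast
  then show ?thesis
  proof cases
    case 1
    with nh have nh: "(?s \<noteq> 0) \<noteq> (?n \<in> Y ?a)" by (simp add: holds_def)
    consider "?a = z" | "?a \<noteq> z" "?a \<in> S" | "?a \<noteq> z" "?a \<notin> S" by blast
    then show ?thesis
    proof cases
      case 1
      with \<open>pfst c = 1\<close> nh c12 show ?thesis by (auto simp: expands_def Y_z split: if_splits)
    next
      case 2
      with \<open>pfst c = 1\<close> c12 obtain s' where c1: "c1 = claim_run s' (p ?a) (ev ?n ?n 0)"
          "?s = 0 \<longleftrightarrow> s' = 0"
        by (auto simp: expands_def split: if_splits)
      have "\<not> holds c1"
        using nh 2 c1 by (auto simp: Y_successor(1) turing_jump_iff)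
      with 2 c1 Y_successor(2,3) show ?thesis by (auto simp: bad_def rank_def lex_code_def)
    next
      case 3
      show ?thesis
      proof (cases "(pfst ?n, ?a) \<in> L \<and> pfst ?n \<noteq> ?a")
        case True
        with \<open>pfst c = 1\<close> 3 c12 have c1: "c1 = claim_mem ?s (pfst ?n) (psnd ?n)"
          by (auto simp: expands_def)
        with True 3 a nh have "\<not> holds c1" by (auto simp: Y_limit)
        with c1 True show ?thesis by (auto simp: bad_def rank_def lex_code_def intro: FieldI1)
      next
        case False
        with \<open>pfst c = 1\<close> 3 c12 have "?s = 0" by (auto simp: expands_def)
        with False 3 a nh show ?thesis by (auto simp: Y_limit)
      qed
    qed
  next
    case 2
    have "\<not> final ?n"
    proof
      assume f: "final ?n"
      with 2 c12 have "?s \<noteq> 0" by (simp add: expands_def)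
      with f 2 nh show False by (auto simp: holds_def dest: spec[of _ 0])
    qed
    with 2 c12 obtain b where s: "?s \<noteq> 1" and b: "b < 2"
      and c1: "c1 = claim_run (?s - 1) ?a (step b ?n)"
      and c2: "c2 = claim_mem b ?a (pfst (psnd ?n))"
      by (auto simp: expands_def)
    show ?thesis
    proof (cases "holds c2")
      case False
      with a 2 c2 show ?thesis by (auto simp: bad_def rank_def lex_code_def)
    next
      case True
      with b c2 have "b = (if pfst (psnd ?n) \<in> Y ?a then 1 else 0)" by auto
      then have c1: "c1 = claim_run (?s - 1) ?a (run (Y ?a) ?n)" by (simp add: run_def c1)
      show ?thesis
      proof (cases "?s = 0")
        case True
        let ?P = "\<lambda>t. halts_in (Y ?a) t ?n"
        from True 2 nh obtain t where t: "?P t" by (auto simp: holds_def)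
        have "?P (Least ?P)" using t by (rule LeastI)
        with \<open>\<not> final ?n\<close> obtain u where u: "Least ?P = Suc u" "halts_in (Y ?a) u (run (Y ?a) ?n)"
          by (cases "Least ?P") auto
        then have "(LEAST t. halts_in (Y ?a) t (run (Y ?a) ?n)) < Least ?P"
          by (simp add: Least_le less_Suc_eq_le)
        moreover have "\<not> holds c1" using u True by (auto simp: c1)
        ultimately show ?thesis
          using True 2 a by (simp add: c1 bad_def rank_def lex_code_def)
      next
        case False
        with s have s: "?s - 1 \<noteq> 0" "?s - 1 < ?s" by auto
        have "\<not> holds c1"
        proof
          assume "holds c1"
          with s obtain t where "t < ?s - 1" "halts_in (Y ?a) (Suc t) ?n" by (auto simp: c1)
          with 2 nh False show False by (auto simp: holds_def dest: spec[of _ "Suc t"])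
        qed
        with False s 2 a show ?thesis by (simp add: c1 bad_def rank_def lex_code_def)
      qed
    qed
  qed
qed

abbreviation "rel \<equiv> lex_code (lex_code (L - Id))"

lemma mem_equimorphic:
  assumes "a \<in> Field L" and "n \<in> Y a"
  shows "equimorphic (kb_order (proofs rel (expands code) (claim_mem 1 a n))) (kb_order (descents rel))"
proof -
  define P where "P c \<longleftrightarrow> holds c \<and> (pfst c = 0 \<or> level c \<in> Field L)" for c
  have "P (claim_mem 1 a n)" using assms by (simp add: P_def)
  moreover have "\<exists>c1 c2. expands code c c1 c2 \<and> P c1 \<and> P c2" if "P c" for c
    using that holds_expands unfolding P_def by blast
  ultimately obtain f :: "nat \<Rightarrow> nat" where "f 0 = claim_mem 1 a n"
      "\<And>i. expands code (f i) (f (2 * i + 1)) (f (2 * i + 2))"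
    using labelling_exists[of P "claim_mem 1 a n" "expands code"] by blast
  then show ?thesis
    unfolding equimorphic_def by (intro conjI embeds_proofs_descents embeds_descents_proofs)
qed

lemma not_mem_strictly_embeds:
  assumes "a \<in> Field L" and "n \<notin> Y a"
  shows "strictly_embeds (kb_order (proofs rel (expands code) (claim_mem 1 a n))) (kb_order (descents rel))"
proof -
  have "wf (lex_code (L - Id))"
    using lwo by (intro wf_lex_code) (simp add: labeled_well_ordering_def well_order_on_def)
  moreover have "bad (claim_mem 1 a n)" using assms by (simp add: bad_def)
  \<comment> \<open>A membership claim has second component 0, so 1 at the same level is a strict
    bound.\<close>
  moreover have "(rank (claim_mem 1 a n), prod_encode (a, 1)) \<in> lex_code (L - Id)"
    by (simp add: rank_def lex_code_def)
  ultimately have "\<not> embeds (kb_order (descents rel))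
      (kb_order (proofs rel (expands code) (claim_mem 1 a n)))"
    using bad_expands by (rule false_not_embeds)
  then show ?thesis by (simp add: strictly_embeds_def embeds_proofs_descents)
qed

end


section \<open>Decidability of the orderings\<close>

text \<open>A nonempty list is coded as the successor of a pair, so \<open>psnd (y - 1)\<close>
  codes the tail. Comparing the result with 0 then tests the length.\<close>

definition drop_code :: "nat \<Rightarrow> nat \<Rightarrow> nat" where
  "drop_code i u = rec_nat u (\<lambda>_ y. psnd (y - 1)) i"

definition nth_code :: "nat \<Rightarrow> nat \<Rightarrow> nat" where
  "nth_code u i = pfst (drop_code i u - 1)"

lemma drop_code: "drop_code i u = list_encode (drop i (list_decode u))"
proof (induction i)
  case 0
  show ?case by (simp add: drop_code_def)
next
  case (Suc i)
  have "drop_code (Suc i) u = psnd (drop_code i u - 1)" by (simp add: drop_code_def)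
  also have "\<dots> = list_encode (drop (Suc i) (list_decode u))"
    unfolding Suc drop_Suc tl_drop[symmetric]
    by (cases "drop i (list_decode u)") simp_all
  finally show ?case .
qed

lemma drop_code_eq_0: "drop_code i u = 0 \<longleftrightarrow> length (list_decode u) \<le> i"
proof -
  have "list_encode xs = 0 \<longleftrightarrow> xs = []" for xs by (cases xs) simp_all
  then show ?thesis by (simp add: drop_code)
qed

lemma nth_code: "i < length (list_decode u) \<Longrightarrow> nth_code u i = list_decode u ! i"
  by (simp add: nth_code_def drop_code Cons_nth_drop_Suc[symmetric])

text \<open>Lets the code itself bound all quantifiers over positions.\<close>

lemma length_list_decode: "length (list_decode u) \<le> u"
proof -
  have "length xs \<le> list_encode xs" for xs
  proof (induction xs)
    case (Cons x xs)
    then show ?case using le_prod_encode_2[of "list_encode xs" x] by simp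
  qed simp
  from this[of "list_decode u"] show ?thesis by simp
qed

lemma ucomputable_drop_code [ucomp]:
  assumes "ucomputable F" and "ucomputable G"
  shows "ucomputable (\<lambda>X x. drop_code (F X x) (G X x))"
  unfolding drop_code_def by (intro ucomputable_rec ucomp assms)

lemma ucomputable_nth_code [ucomp]:
  assumes "ucomputable F" and "ucomputable G"
  shows "ucomputable (\<lambda>X x. nth_code (F X x) (G X x))"
  unfolding nth_code_def by (intro ucomp assms)

lemma udecidable_le_of [ucomp]:
  assumes "ucomputable F" and "ucomputable G"
  shows "udecidable (\<lambda>X x. le_of X (F X x) (G X x))"
  unfolding le_of_def by (intro ucomp assms)

definition rel_of :: "nat set \<Rightarrow> nat rel" where
  "rel_of X = lex_code (lex_code {(a, b). le_of X a b \<and> a \<noteq> b})"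

lemma udecidable_rel_of [ucomp]:
  assumes "ucomputable F" and "ucomputable G"
  shows "udecidable (\<lambda>X x. (F X x, G X x) \<in> rel_of X)"
  unfolding rel_of_def lex_code_def mem_Collect_eq prod.case by (intro ucomp assms)

lemma udecidable_expands [ucomp]:
  assumes "ucomputable F" and "ucomputable G" and "ucomputable H"
  shows "udecidable (\<lambda>X x. expands X (F X x) (G X x) (H X x))"
proof -
  \<comment> \<open>Proved first for one coded triple, so that only projections occur under the
    quantifier over \<open>b\<close>.\<close>
  have "udecidable (\<lambda>X z. expands X (pfst z) (pfst (psnd z)) (psnd (psnd z)))"
    unfolding expands_def claim_mem_def claim_run_def level_def param_def arg_def
      least_of_def successor_of_def pred_of_def ev_def
    by (intro ucomp)
  from udecidable_comp[OF this, of "\<lambda>X x. prod_encode (F X x, prod_encode (G X x, H X x))"]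
  show ?thesis by (simp add: ucomp assms)
qed

lemma list_decode_descents_iff:
  "list_decode u \<in> descents R \<longleftrightarrow> drop_code 0 u \<noteq> 0 \<and>
    (\<forall>i<u. drop_code (Suc i) u \<noteq> 0 \<longrightarrow> (pfst (nth_code u (Suc i)), pfst (nth_code u i)) \<in> R)"
  using length_list_decode[of u]
  by (auto simp: descents_def drop_code_eq_0 nth_code not_le)

lemma list_decode_proofs_iff:
  "list_decode u \<in> proofs R E c \<longleftrightarrow> list_decode u \<in> descents R \<and> claim (nth_code u 0) = c \<and>
    (\<forall>i<u. drop_code (2 * i + 2) u \<noteq> 0 \<longrightarrow>
      E (claim (nth_code u i)) (claim (nth_code u (2 * i + 1))) (claim (nth_code u (2 * i + 2))))"
proof (cases "list_decode u \<in> descents R")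
  case True
  then have "nth_code u 0 = list_decode u ! 0" by (simp add: descents_def nth_code)
  moreover have "i < u" if "2 * i + 2 < length (list_decode u)" for i
    using that length_list_decode[of u] by simp
  ultimately show ?thesis
    using True by (auto simp: proofs_def drop_code_eq_0 nth_code not_le)
qed (simp add: proofs_def)

text \<open>The disjunct \<open>drop_code (i - 1) v \<noteq> 0\<close>, with the case
  \<open>i = 0\<close> apart, expresses that \<open>i\<close> is at most the length of the second
  list.\<close>

lemma list_decode_kb_iff:
  "kb (list_decode u) (list_decode v) \<longleftrightarrow>
    (\<exists>i<u. drop_code i u \<noteq> 0 \<and> (i = 0 \<or> drop_code (i - 1) v \<noteq> 0) \<and>
      (\<forall>j<i. nth_code u j = nth_code v j) \<and>
      (drop_code i v \<noteq> 0 \<longrightarrow> nth_code u i < nth_code v i))"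
proof -
  have "i < length (list_decode u) \<and> i \<le> length (list_decode v) \<and>
      (\<forall>j<i. list_decode u ! j = list_decode v ! j) \<and>
      (i < length (list_decode v) \<longrightarrow> list_decode u ! i < list_decode v ! i) \<longleftrightarrow>
    i < u \<and> drop_code i u \<noteq> 0 \<and> (i = 0 \<or> drop_code (i - 1) v \<noteq> 0) \<and>
      (\<forall>j<i. nth_code u j = nth_code v j) \<and>
      (drop_code i v \<noteq> 0 \<longrightarrow> nth_code u i < nth_code v i)" for i
  proof (cases "i < length (list_decode u) \<and> i \<le> length (list_decode v)")
    case True
    then show ?thesis
      using length_list_decode[of u] by (auto simp: drop_code_eq_0 nth_code not_le)
        (metis One_nat_def diff_less length_greater_0_conv zero_less_one)
  next
    case False
    then show ?thesis by (auto simp: drop_code_eq_0 not_le)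
  qed
  then show ?thesis unfolding kb_nth by blast
qed

lemma kb_order_decode:
  "(u, v) \<in> kb_order T \<longleftrightarrow> list_decode u \<in> T \<and> list_decode v \<in> T \<and>
    (u = v \<or> kb (list_decode u) (list_decode v))"
  using kb_order_iff[of "list_decode u" "list_decode v" T] by simp (metis list_decode_inverse)

lemma udecidable_kb_order:
  assumes T: "udecidable (\<lambda>X z. list_decode (psnd z) \<in> T X (pfst z))"
    and "ucomputable C" and "ucomputable F" and "ucomputable G"
  shows "udecidable (\<lambda>X x. (F X x, G X x) \<in> kb_order (T X (C X x)))"
proof -
  have T': "udecidable (\<lambda>X x. list_decode (H X x) \<in> T X (C X x))" if "ucomputable H" for H
    using udecidable_comp[OF T ucomputable_pair[OF assms(2) that]] by simp
  show ?thesis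
    unfolding kb_order_decode list_decode_kb_iff by (intro ucomp assms T' ucomputable_comp[OF assms(3)] ucomputable_comp[OF assms(4)])
qed

lemma udecidable_descents:
  assumes "ucomputable F"
  shows "udecidable (\<lambda>X x. list_decode (F X x) \<in> descents (rel_of X))"
  unfolding list_decode_descents_iff by (intro ucomp ucomputable_comp[OF assms] assms)

lemma udecidable_proofs:
  assumes "ucomputable F" and "ucomputable G"
  shows "udecidable (\<lambda>X x. list_decode (F X x) \<in> proofs (rel_of X) (expands X) (G X x))"
  unfolding list_decode_proofs_iff
  by (intro ucomp udecidable_descents ucomputable_comp[OF assms(1)] assms)

text \<open>This ordering and \<open>test_order\<close> depend on the oracle alone; the jump
  hierarchy enters only their verification.\<close>

definition big_order :: "nat set \<Rightarrow> nat rel" where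
  "big_order X = kb_order (descents (rel_of X))"

definition test_order :: "nat set \<Rightarrow> nat \<Rightarrow> nat \<Rightarrow> nat rel" where
  "test_order X a n = kb_order (proofs (rel_of X) (expands X) (claim_mem 1 a n))"

text \<open>By reflexivity the set of all \<open>a\<close> with \<open>le_of X a a\<close> is the
  field of \<open>L\<close> when \<open>X\<close> is its code, and it is decided by one oracle
  question.\<close>

lemma udecidable_orders:
  "udecidable (\<lambda>X x. x \<in> order_code (big_order X) \<oplus>
     big_join {a. le_of X a a} (\<lambda>a. big_join UNIV (\<lambda>n. order_code (test_order X a n))))"
  (is "udecidable ?P")
proof -
  have "udecidable (\<lambda>X x. if x mod Suc 1 = 0
      then (pfst (x div Suc 1), psnd (x div Suc 1)) \<in> big_order X
      else le_of X (pfst (x div Suc 1)) (pfst (x div Suc 1)) \<and>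
        (pfst (psnd (psnd (x div Suc 1))), psnd (psnd (psnd (x div Suc 1)))) \<in>
          test_order X (pfst (x div Suc 1)) (pfst (psnd (x div Suc 1))))"
    (is "udecidable ?Q")
    unfolding big_order_def test_order_def claim_mem_def
    by (intro ucomp udecidable_kb_order[where C = "\<lambda>X x. x" and T = "\<lambda>X _. descents (rel_of X)"]
      udecidable_kb_order[where T = "\<lambda>X. proofs (rel_of X) (expands X)"]
      udecidable_descents udecidable_proofs)
  moreover have "?Q = ?P"
  proof (intro ext)
    fix X x
    have "x = 2 * (x div 2) \<or> x = Suc (2 * (x div 2))" by presburger
    then consider y where "x = 2 * y" | y where "x = Suc (2 * y)" by blast
    then show "?Q X x = ?P X x"
      by cases (simp_all add: order_code_iff big_join_iff numeral_2_eq_2[symmetric])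
  qed
  ultimately show ?thesis by (simp only:)
qed

theorem theorem5p8:
  shows "\<exists>e. \<forall>L z S p. labeled_well_ordering L z S p \<longrightarrow>
    (\<exists>(M :: nat rel) (K :: nat \<Rightarrow> nat \<Rightarrow> nat rel).
       decides (lwo_code L z S p) e
         (order_code M \<oplus> big_join (Field L) (\<lambda>a. big_join UNIV (\<lambda>n. order_code (K a n)))) \<and>
       Well_order M \<and> indecomposable M \<and>
       (\<forall>a\<in>Field L. \<forall>n. Well_order (K a n)) \<and>
       (\<forall>Y. jump_hierarchy L z S p Y \<longrightarrow>
         (\<forall>a\<in>Field L. \<forall>n.
           (n \<in> Y a \<longrightarrow> equimorphic (K a n) M) \<and>
           (n \<notin> Y a \<longrightarrow> strictly_embeds (K a n) M))))"
proof -
  \<comment> \<open>The program is fixed here, before any labeled well-ordering is given.\<close>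
  obtain e where e: "\<And>X. decides X e (order_code (big_order X) \<oplus>
     big_join {a. le_of X a a} (\<lambda>a. big_join UNIV (\<lambda>n. order_code (test_order X a n))))"
    using udecidable_orders unfolding udecidable_def ucomputable_def decides_def by blast
  show ?thesis
  proof (intro exI[of _ e] allI impI)
    fix L z S p
    assume lwo: "labeled_well_ordering L z S p"
    let ?X = "lwo_code L z S p"
    have L: "Well_order L" using lwo by (simp add: labeled_well_ordering_def)
    then have Field: "{a. le_of ?X a a} = Field L"
      by (auto simp: order_on_defs refl_on_def intro: FieldI1)
    \<comment> \<open>On a code, the relation read from the oracle is the one used in the
      locale.\<close>
    have rel: "rel_of ?X = lex_code (lex_code (L - Id))"
      by (auto simp: rel_of_def intro!: arg_cong[of _ _ lex_code])
    have wf: "wf (rel_of ?X)"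
      unfolding rel using L by (intro wf_lex_code) (simp add: well_order_on_def)
    have "Well_order (big_order ?X)" "Well_order (test_order ?X a n)" for a n
      unfolding big_order_def test_order_def
      by (rule Well_order_kb_order[OF wf]; auto simp: proofs_def)+
    moreover have "indecomposable (big_order ?X)"
      unfolding big_order_def by (rule indecomposable_kb_descents)
    moreover have "equimorphic (test_order ?X a n) (big_order ?X)"
      if "jump_hierarchy L z S p Y" "a \<in> Field L" "n \<in> Y a" for Y a n
    proof -
      interpret hierarchy L z S p Y using lwo that(1) by unfold_locales
      show ?thesis
        unfolding big_order_def test_order_def rel using that(2,3) by (rule mem_equimorphic)
    qed
    moreover have "strictly_embeds (test_order ?X a n) (big_order ?X)"
      if "jump_hierarchy L z S p Y" "a \<in> Field L" "n \<notin> Y a" for Y a n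
    proof -
      interpret hierarchy L z S p Y using lwo that(1) by unfold_locales
      show ?thesis
        unfolding big_order_def test_order_def rel using that(2,3) by (rule not_mem_strictly_embeds)
    qed
    moreover note e[of ?X, unfolded Field]
    ultimately show "\<exists>(M :: nat rel) (K :: nat \<Rightarrow> nat \<Rightarrow> nat rel).
       decides (lwo_code L z S p) e
         (order_code M \<oplus> big_join (Field L) (\<lambda>a. big_join UNIV (\<lambda>n. order_code (K a n)))) \<and>
       Well_order M \<and> indecomposable M \<and>
       (\<forall>a\<in>Field L. \<forall>n. Well_order (K a n)) \<and>
       (\<forall>Y. jump_hierarchy L z S p Y \<longrightarrow>
         (\<forall>a\<in>Field L. \<forall>n.
           (n \<in> Y a \<longrightarrow> equimorphic (K a n) M) \<and>
           (n \<notin> Y a \<longrightarrow> strictly_embeds (K a n) M)))"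
      by (intro exI[of _ "big_order ?X"] exI[of _ "test_order ?X"]) simp
  qed
qed

end
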